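(* Let $\mathcal X,\mathcal Y$ be real Hilbert spaces, $f:\mathcal X\to(-\infty,+\infty]$ proper, convex and lower semicontinuous, $A:\mathcal X\to\mathcal Y$ bounded linear, $b\in\mathcal Y$, and $g=\iota_{\{b\}}$ (so $g^*(y)=\langle b,y\rangle$). Let $\zeta:[0,+\infty)\to[0,+\infty)$ be locally integrable, let $\alpha_0,\delta_0,\nu_0>0$, put $\Xi(t)=\exp\left(\int_0^t\zeta(s)\,ds\right)$, and define $$\alpha(t)=\frac{\alpha_0}{\Xi(t)},\qquad \delta(t)=\frac{\delta_0}{\Xi(t)},\qquad \nu(t)=\frac{1}{\Xi(t)}\left[\nu_0+\int_0^t\Xi(s)\,ds\right].$$ Let $\beta:[0,+\infty)\to[0,+\infty)$ be any nonnegative function and let $(x,y):[0,+\infty)\to\mathcal X\times\mathcal Y$ be a trajectory, with $(x(0),y(0))=(x_0,y_0)$, of $$\left\{\begin{array}{rcl}\alpha(t)\dot x(t)+\beta(t)A^*\dot y(t)+\partial f(x(t))+A^*y(t)&\ni&0\\ -\nu(t)A\dot x(t)+\delta(t)\dot y(t)-Ax(t)+b&=&0.\end{array}\right.$$ Then, for every $(\bar x,\bar y)\in\mathcal S$ and every $t\ge 0$, writing $$\mathcal E_0=\frac{\alpha_0}{2}\|x_0-\bar x\|^2+\frac{\delta_0}{2}\|y_0-\bar y\|^2+\nu_0\big[f(x_0)-f(\bar x)+\langle\bar y,Ax_0-b\rangle\big],$$ $$\mathcal K_0=\nu_0\|Ax_0-b\|+\delta_0\|\bar y-y_0\|+\sqrt{2\delta_0\mathcal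 E_0},$$ we have $$\Delta_{\bar x,\bar y}(t)\le\frac{\mathcal E_0}{\nu_0+\int_0^t\Xi(s)\,ds},\qquad \frac{\alpha_0}{2}\|x(t)-\bar x\|^2+\frac{\delta_0}{2}\|y(t)-\bar y\|^2\le\mathcal E_0,$$ $$\|Ax(t)-b\|\le\frac{\mathcal K_0}{\nu_0+\int_0^t\Xi(s)\,ds},\qquad |f(x(t))-f(\bar x)|\le\frac{\mathcal E_0+\|\bar y\|\mathcal K_0}{\nu_0+\int_0^t\Xi(s)\,ds}.$$ Moreover, every weak subsequential limit point $(x_*,y_* )$ of $(x(t),y(t))$ as $t\to+\infty$ is such that $(x_*,\bar y)\in\mathcal S$. If in addition $f$ is $\mu$-strongly convex ($\mu>0$), then $$\|x(t)-\bar x\|^2\le\frac{2\mathcal E_0}{\mu\left(\nu_0+\int_0^t\Xi(s)\,ds\right)},$$ and $x(t)$ converges strongly, as $t\to+\infty$, to the unique minimizer $\bar x$ of $f$ subject to $Ax=b$. Similarly, if $g$ is $L$-smooth ($L>0$), then $$\|y(t)-\bar y\|^2\le\frac{2L\,\mathcal E_0}{\nu_0+\int_0^t\Xi(s)\,ds}.$$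
   Context: $A^*$ is the adjoint of $A$, $\partial$ the convex subdifferential, $g^*$ the Fenchel conjugate of $g$, $\iota_{\{b\}}$ the function equal to $0$ at $b$ and $+\infty$ elsewhere. The underlying problem is $\min_{x\in\mathcal X} f(x)+g(Ax)$, i.e. $\min\{f(x):Ax=b\}$. A primal-dual solution is a pair $(\bar x,\bar y)\in\mathcal X\times\mathcal Y$ with $-A^*\bar y\in\partial f(\bar x)$ and $A\bar x\in\partial g^*(\bar y)$ (here: $A\bar x=b$); $\mathcal S$ is the set of primal-dual solutions. The Lagrangian is $\mathcal L(u,v)=f(u)+\langle v,Au\rangle-g^*(v)$ and the duality gap along $(x,y)$ is $\Delta_{u,v}(t)=\mathcal L(x(t),v)-\mathcal L(u,y(t))$. For $(\bar x,\bar y)\in\mathcal S$ this gives $\Delta_{\bar x,\bar y}(t)=f(x(t))-f(\bar x)+\langle\bar y,Ax(t)-b\rangle$. A trajectory of the system is a pair of functions $x:[0,+\infty)\to\mathcal X$, $y:[0,+\infty)\to\mathcal Y$ that are locally absolutely continuous, such that $f\circ x$ and $g^*\circ y$ are (finite and) locally absolutely continuous on $[0,+\infty)$, and the system holds for almost every $t>0$. A weak subsequential limit point of $(x(t),y(t))$ as $t\to+\infty$ is a weak limit of $(x(t_k),y(t_k))$ for some sequence $t_k\to+\infty$. "$g$ is $L$-smooth" means $g$ is differentiable with $L$-Lipschitz gradient. *)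

theory Defs
  imports "HOL-Analysis.Analysis"
begin

section \<open>Convex analysis for extended-real-valued functions\<close>

definition proper_fun :: "('a \<Rightarrow> ereal) \<Rightarrow> bool" where
  "proper_fun f \<longleftrightarrow> (\<forall>x. f x \<noteq> -\<infinity>) \<and> (\<exists>x. f x \<noteq> \<infinity>)"

text \<open>The inequalities below are used for functions that never take the value \<open>-\<infinity>\<close>; since
  \<open>0 * \<infinity> = 0\<close> in \<^typ>\<open>ereal\<close>, the end points \<open>s = 0\<close> and \<open>s = 1\<close> are harmless.\<close>

definition convex_fun :: "('a::real_vector \<Rightarrow> ereal) \<Rightarrow> bool" where
  "convex_fun f \<longleftrightarrow> (\<forall>x z s. 0 \<le> s \<and> s \<le> 1 \<longrightarrow>
     f ((1 - s) *\<^sub>R x + s *\<^sub>R z) \<le> ereal (1 - s) * f x + ereal s * f z)"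

definition strongly_convex_fun :: "real \<Rightarrow> ('a::real_inner \<Rightarrow> ereal) \<Rightarrow> bool" where
  "strongly_convex_fun \<mu> f \<longleftrightarrow> (\<forall>x z s. 0 \<le> s \<and> s \<le> 1 \<longrightarrow>
     f ((1 - s) *\<^sub>R x + s *\<^sub>R z) + ereal (\<mu> / 2 * s * (1 - s) * (norm (x - z))\<^sup>2)
       \<le> ereal (1 - s) * f x + ereal s * f z)"

definition lsc_fun :: "('a::topological_space \<Rightarrow> ereal) \<Rightarrow> bool" where
  "lsc_fun f \<longleftrightarrow> (\<forall>x. f x \<le> Liminf (nhds x) f)"

text \<open>For proper \<open>f\<close> this is empty at every point where \<open>f\<close> is infinite.\<close>

definition subdifferential :: "('a::real_inner \<Rightarrow> ereal) \<Rightarrow> 'a \<Rightarrow> 'a set" where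
  "subdifferential f x = {\<xi>. \<forall>z. f x + ereal (\<xi> \<bullet> (z - x)) \<le> f z}"

definition fenchel_conjugate :: "('a::real_inner \<Rightarrow> ereal) \<Rightarrow> 'a \<Rightarrow> ereal" where
  "fenchel_conjugate g v = (SUP w. ereal (v \<bullet> w) - g w)"

definition indicator_at :: "'a \<Rightarrow> 'a \<Rightarrow> ereal" where
  "indicator_at b = (\<lambda>w. if w = b then 0 else \<infinity>)"

text \<open>An \<open>L\<close>-smooth extended-real-valued function is in particular finite everywhere.\<close>

definition smooth_fun :: "real \<Rightarrow> ('a::real_inner \<Rightarrow> ereal) \<Rightarrow> bool" where
  "smooth_fun L g \<longleftrightarrow> (\<exists>h G. (\<forall>w. g w = ereal (h w)) \<and> (\<forall>w. GDERIV h w :> G w) \<and>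
     L-lipschitz_on UNIV G)"

section \<open>Lagrangian, duality gap, and primal-dual solutions of min f(x) + g(A x)\<close>

definition lagrangian ::
  "('a::real_inner \<Rightarrow> ereal) \<Rightarrow> ('b::real_inner \<Rightarrow> ereal) \<Rightarrow> ('a \<Rightarrow> 'b) \<Rightarrow> 'a \<Rightarrow> 'b \<Rightarrow> ereal" where
  "lagrangian f g A u v = f u + ereal (v \<bullet> A u) - fenchel_conjugate g v"

definition duality_gap ::
  "('a::real_inner \<Rightarrow> ereal) \<Rightarrow> ('b::real_inner \<Rightarrow> ereal) \<Rightarrow> ('a \<Rightarrow> 'b) \<Rightarrow>
   (real \<Rightarrow> 'a) \<Rightarrow> (real \<Rightarrow> 'b) \<Rightarrow> 'a \<Rightarrow> 'b \<Rightarrow> real \<Rightarrow> ereal" where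
  "duality_gap f g A x y u v t = lagrangian f g A (x t) v - lagrangian f g A u (y t)"

definition primal_dual_solutions ::
  "('a::real_inner \<Rightarrow> ereal) \<Rightarrow> ('b::real_inner \<Rightarrow> ereal) \<Rightarrow> ('a \<Rightarrow> 'b) \<Rightarrow> ('a \<times> 'b) set" where
  "primal_dual_solutions f g A =
     {(u, v). - adjoint A v \<in> subdifferential f u \<and>
              A u \<in> subdifferential (fenchel_conjugate g) v}"

section \<open>Trajectories\<close>

definition absolutely_continuous_on :: "real \<Rightarrow> real \<Rightarrow> (real \<Rightarrow> 'a::real_normed_vector) \<Rightarrow> bool" where
  "absolutely_continuous_on a b h \<longleftrightarrow>
     (\<forall>\<epsilon>>0. \<exists>\<eta>>0. \<forall>(n::nat) l r.
        (\<forall>i<n. a \<le> l i \<and> l i \<le> r i \<and> r i \<le> b) \<and>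
        (\<forall>i<n. \<forall>j<n. i \<noteq> j \<longrightarrow> {l i<..<r i} \<inter> {l j<..<r j} = {}) \<and>
        (\<Sum>i<n. r i - l i) < \<eta>
        \<longrightarrow> (\<Sum>i<n. norm (h (r i) - h (l i))) < \<epsilon>)"

text \<open>Local absolute continuity on \<open>[0,+\<infinity>)\<close>.\<close>

definition locally_absolutely_continuous :: "(real \<Rightarrow> 'a::real_normed_vector) \<Rightarrow> bool" where
  "locally_absolutely_continuous h \<longleftrightarrow> (\<forall>T\<ge>0. absolutely_continuous_on 0 T h)"

definition ereal_locally_absolutely_continuous :: "(real \<Rightarrow> ereal) \<Rightarrow> bool" where
  "ereal_locally_absolutely_continuous h \<longleftrightarrow>
     (\<forall>t\<ge>0. \<bar>h t\<bar> \<noteq> \<infinity>) \<and> locally_absolutely_continuous (\<lambda>t. real_of_ereal (h t))"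

text \<open>Functions on \<open>[0,+\<infinity>)\<close> are represented by functions on \<^typ>\<open>real\<close> whose values at
  negative arguments play no role. That the system holds at \<open>t\<close> includes differentiability of
  \<open>x\<close> and \<open>y\<close> at \<open>t\<close>.\<close>

definition trajectory ::
  "('a::real_inner \<Rightarrow> ereal) \<Rightarrow> ('a \<Rightarrow> 'b::real_inner) \<Rightarrow> 'b \<Rightarrow>
   (real \<Rightarrow> real) \<Rightarrow> (real \<Rightarrow> real) \<Rightarrow> (real \<Rightarrow> real) \<Rightarrow> (real \<Rightarrow> real) \<Rightarrow>
   (real \<Rightarrow> 'a) \<Rightarrow> (real \<Rightarrow> 'b) \<Rightarrow> bool" where
  "trajectory f A b \<alpha> \<beta> \<delta> \<nu> x y \<longleftrightarrow>
     locally_absolutely_continuous x \<and>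
     locally_absolutely_continuous y \<and>
     ereal_locally_absolutely_continuous (\<lambda>t. f (x t)) \<and>
     ereal_locally_absolutely_continuous (\<lambda>t. fenchel_conjugate (indicator_at b) (y t)) \<and>
     (AE t in lebesgue. t > 0 \<longrightarrow>
        (\<exists>x' y'. (x has_vector_derivative x') (at t) \<and> (y has_vector_derivative y') (at t) \<and>
           0 \<in> {\<alpha> t *\<^sub>R x' + \<beta> t *\<^sub>R adjoint A y' + \<xi> + adjoint A (y t) | \<xi>.
                  \<xi> \<in> subdifferential f (x t)} \<and>
           - (\<nu> t *\<^sub>R A x') + \<delta> t *\<^sub>R y' - A (x t) + b = 0))"

section \<open>Weak limits\<close>

definition weakly_converges :: "(nat \<Rightarrow> 'a::real_normed_vector) \<Rightarrow> 'a \<Rightarrow> bool" where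
  "weakly_converges u l \<longleftrightarrow>
     (\<forall>\<phi>::'a \<Rightarrow> real. bounded_linear \<phi> \<longrightarrow> (\<lambda>k. \<phi> (u k)) \<longlonglongrightarrow> \<phi> l)"

definition weak_limit_point_at_top :: "(real \<Rightarrow> 'a::real_normed_vector) \<Rightarrow> 'a \<Rightarrow> bool" where
  "weak_limit_point_at_top z l \<longleftrightarrow>
     (\<exists>s::nat \<Rightarrow> real. filterlim s at_top sequentially \<and> weakly_converges (\<lambda>k. z (s k)) l)"

end

theory Submission
  imports Defs
begin

text \<open>
  Multiplying the system by \<open>\<Xi>\<close> makes the coefficients of \<open>x'\<close> and \<open>y'\<close> (in the first and
  the second line respectively) the constants \<open>\<alpha>\<^sub>0\<close> and \<open>\<delta>\<^sub>0\<close>, and turns \<open>\<nu>\<close> into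
  \<open>M t = \<nu>\<^sub>0 + \<integral>\<Xi>\<close>, a primitive of \<open>\<Xi>\<close>.  Two facts then give everything.

  First, the energy
  \<open>\<alpha>\<^sub>0 / 2 * (norm (x t - xb))\<^sup>2 + \<delta>\<^sub>0 / 2 * (norm (y t - yb))\<^sup>2 + M t * gap t\<close>
  decreases (\<open>energy_decreasing\<close>): in its derivative the coupling terms cancel and
  \<open>- M * \<alpha> * (norm x')\<^sup>2 - \<beta> * \<delta>\<^sub>0 * (norm y')\<^sup>2\<close> is left as an upper bound
  (\<open>lyapunov_derivative_nonpos\<close>).  Since the gap is nonnegative at a saddle point, this bounds the
  gap and both distances.  Second, the dual equation says that \<open>M t *\<^sub>R (A (x t) - b) - \<delta>\<^sub>0 *\<^sub>R y t\<close>
  is constant (\<open>residual_conservation\<close>), so that boundedness of \<open>y\<close> gives the rate for the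
  residual, and with it the rate for the objective.

  Since \<open>\<Xi> \<ge> 1\<close>, \<open>M\<close> tends to infinity.  At a weak limit point, feasibility follows from weak
  continuity of \<open>A\<close> and optimality from the weak closedness of the sublevel sets of \<open>f\<close>
  (\<open>weak_limit_point_is_solution\<close>).  Under strong convexity the gap dominates the squared distance
  to \<open>xb\<close>.  The indicator function of a point is smooth only on the trivial space, where the last
  bound is clear.

  The analytic point is that the system holds only almost everywhere, and that \<open>f \<circ> x\<close> is merely
  absolutely continuous.  A subgradient at \<open>x t\<close> bounds the left difference quotients of
  \<open>f \<circ> x\<close> at \<open>t\<close> from above, so it is enough to know that an absolutely continuous function with
  nonpositive left quotients in the limit, outside a null set, decreases
  (\<open>absolutely_continuous_on_decreasing\<close>).  The existence of adjoints and the weak closedness of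
  closed convex sets both rest on projections in Hilbert spaces (\<open>closed_convex_projection\<close>).
\<close>

section \<open>Absolutely continuous functions\<close>

definition nonoverlapping_in :: "real \<Rightarrow> real \<Rightarrow> nat \<Rightarrow> (nat \<Rightarrow> real) \<Rightarrow> (nat \<Rightarrow> real) \<Rightarrow> bool" where
  "nonoverlapping_in a b n l r \<longleftrightarrow> (\<forall>i<n. a \<le> l i \<and> l i \<le> r i \<and> r i \<le> b) \<and>
     (\<forall>i<n. \<forall>j<n. i \<noteq> j \<longrightarrow> {l i<..<r i} \<inter> {l j<..<r j} = {})"

lemma absolutely_continuous_on_iff:
  "absolutely_continuous_on a b h \<longleftrightarrow> (\<forall>e>0. \<exists>d>0. \<forall>n l r.
     nonoverlapping_in a b n l r \<and> (\<Sum>i<n. r i - l i) < d \<longrightarrow> (\<Sum>i<n. norm (h (r i) - h (l i))) < e)"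
  unfolding absolutely_continuous_on_def nonoverlapping_in_def conj_assoc ..

lemma absolutely_continuous_on_imp_continuous_on:
  assumes "absolutely_continuous_on a b h"
  shows "continuous_on {a..b} h"
proof (rule continuous_onI)
  fix s e :: real assume s: "s \<in> {a..b}" and e: "e > 0"
  obtain d where d: "d > 0" and D: "\<And>n l r. \<lbrakk>nonoverlapping_in a b n l r; (\<Sum>i<n. r i - l i) < d\<rbrakk> \<Longrightarrow>
        (\<Sum>i<n. norm (h (r i) - h (l i))) < e"
    using assms e unfolding absolutely_continuous_on_iff by meson
  have "dist (h t) (h s) \<le> e" if t: "t \<in> {a..b}" and "dist t s < d" for t
  proof -
    have "(\<Sum>i<(1::nat). norm (h (max s t) - h (min s t))) < e"
      by (rule D) (use s t that in \<open>auto simp: dist_real_def nonoverlapping_in_def\<close>)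
    then show ?thesis
      by (cases "s \<le> t") (auto simp: dist_norm max_def min_def norm_minus_commute)
  qed
  with d show "\<exists>d>0. \<forall>t\<in>{a..b}. dist t s < d \<longrightarrow> dist (h t) (h s) \<le> e"
    by blast
qed

text \<open>All closure properties of absolute continuity that are needed come from this one: whatever
  is controlled by the increments of two absolutely continuous functions is absolutely
  continuous.\<close>

lemma absolutely_continuous_on_dominated:
  assumes h: "absolutely_continuous_on a b h" and k: "absolutely_continuous_on a b k"
    and C: "C \<ge> 0"
    and le: "\<And>u v. \<lbrakk>a \<le> u; u \<le> v; v \<le> b\<rbrakk> \<Longrightarrow>
      norm (p v - p u) \<le> C * (norm (h v - h u) + norm (k v - k u))"
  shows "absolutely_continuous_on a b p"
  unfolding absolutely_continuous_on_iff
proof (intro allI impI)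
  fix e :: real assume e: "e > 0"
  define e' where "e' = e / (2 * (C + 1))"
  have e': "e' > 0" using e C by (simp add: e'_def)
  obtain d1 where d1: "d1 > 0" and D1: "\<And>n l r. \<lbrakk>nonoverlapping_in a b n l r; (\<Sum>i<n. r i - l i) < d1\<rbrakk> \<Longrightarrow>
        (\<Sum>i<n. norm (h (r i) - h (l i))) < e'"
    using h e' unfolding absolutely_continuous_on_iff by meson
  obtain d2 where d2: "d2 > 0" and D2: "\<And>n l r. \<lbrakk>nonoverlapping_in a b n l r; (\<Sum>i<n. r i - l i) < d2\<rbrakk> \<Longrightarrow>
        (\<Sum>i<n. norm (k (r i) - k (l i))) < e'"
    using k e' unfolding absolutely_continuous_on_iff by meson
  show "\<exists>d>0. \<forall>n l r. nonoverlapping_in a b n l r \<and> (\<Sum>i<n. r i - l i) < d \<longrightarrow>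
      (\<Sum>i<n. norm (p (r i) - p (l i))) < e"
  proof (intro exI[of _ "min d1 d2"] conjI allI impI)
    show "min d1 d2 > 0" using d1 d2 by simp
    fix n :: nat and l r
    assume A: "nonoverlapping_in a b n l r \<and> (\<Sum>i<n. r i - l i) < min d1 d2"
    have "(\<Sum>i<n. norm (p (r i) - p (l i)))
        \<le> (\<Sum>i<n. C * (norm (h (r i) - h (l i)) + norm (k (r i) - k (l i))))"
      by (rule sum_mono) (use A le in \<open>auto simp: nonoverlapping_in_def\<close>)
    also have "\<dots> = C * ((\<Sum>i<n. norm (h (r i) - h (l i))) + (\<Sum>i<n. norm (k (r i) - k (l i))))"
      by (simp add: sum_distrib_left sum.distrib distrib_left)
    also have "\<dots> \<le> C * (e' + e')"
    proof (rule mult_left_mono)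
      have "(\<Sum>i<n. norm (h (r i) - h (l i))) < e'"
        by (rule D1) (use A in auto)
      moreover have "(\<Sum>i<n. norm (k (r i) - k (l i))) < e'"
        by (rule D2) (use A in auto)
      ultimately show "(\<Sum>i<n. norm (h (r i) - h (l i))) + (\<Sum>i<n. norm (k (r i) - k (l i))) \<le> e' + e'"
        by linarith
    qed (rule C)
    also have "\<dots> < e"
      using e' C e by (simp add: e'_def divide_simps)
    finally show "(\<Sum>i<n. norm (p (r i) - p (l i))) < e" .
  qed
qed

lemma absolutely_continuous_on_id: "absolutely_continuous_on a b (\<lambda>t::real. t)"
proof -
  have "(\<Sum>i<n. norm (r i - l i)) = (\<Sum>i<n. r i - l i)" if "nonoverlapping_in a b n l r" for n l r
    by (rule sum.cong) (use that in \<open>auto simp: nonoverlapping_in_def\<close>)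
  then show ?thesis
    unfolding absolutely_continuous_on_iff by metis
qed

lemma absolutely_continuous_on_add:
  assumes "absolutely_continuous_on a b h" and "absolutely_continuous_on a b k"
  shows "absolutely_continuous_on a b (\<lambda>t. h t + k t)"
proof (rule absolutely_continuous_on_dominated[OF assms, of 1])
  show "norm (h v + k v - (h u + k u)) \<le> 1 * (norm (h v - h u) + norm (k v - k u))" for u v
    using norm_triangle_ineq[of "h v - h u" "k v - k u"] by (simp add: algebra_simps)
qed simp

lemma absolutely_continuous_on_bounded_linear:
  assumes "bounded_linear L" and "absolutely_continuous_on a b h"
  shows "absolutely_continuous_on a b (\<lambda>t. L (h t))"
proof -
  interpret bounded_linear L by fact
  obtain C where C: "C > 0" "\<And>z. norm (L z) \<le> norm z * C"
    using pos_bounded by blast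
  show ?thesis
  proof (rule absolutely_continuous_on_dominated[OF assms(2) assms(2), of C])
    show "norm (L (h v) - L (h u)) \<le> C * (norm (h v - h u) + norm (h v - h u))" for u v
      using C(2)[of "h v - h u"] mult_nonneg_nonneg[OF norm_ge_zero[of "h v - h u"] less_imp_le[OF C(1)]]
      unfolding diff[symmetric] distrib_left mult.commute[of C] by linarith
  qed (use C in simp)
qed

lemma absolutely_continuous_on_const: "absolutely_continuous_on a b (\<lambda>t. c)"
  by (rule absolutely_continuous_on_dominated[OF absolutely_continuous_on_id
        absolutely_continuous_on_id, of 0]) simp_all

lemma absolutely_continuous_on_diff:
  assumes "absolutely_continuous_on a b h" and "absolutely_continuous_on a b k"
  shows "absolutely_continuous_on a b (\<lambda>t. h t - k t)"
  using absolutely_continuous_on_add[OF assms(1)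
      absolutely_continuous_on_bounded_linear[OF bounded_linear_minus[OF bounded_linear_ident] assms(2)]]
  by simp

lemma absolutely_continuous_on_bounded_bilinear:
  assumes "bounded_bilinear B"
    and h: "absolutely_continuous_on a b h" and k: "absolutely_continuous_on a b k"
  shows "absolutely_continuous_on a b (\<lambda>t. B (h t) (k t))"
proof -
  interpret bounded_bilinear B by fact
  have bdd: "bounded (h ` {a..b})" "bounded (k ` {a..b})"
    using h k by (auto intro!: compact_imp_bounded compact_continuous_image
        absolutely_continuous_on_imp_continuous_on)
  obtain P where P: "P > 0" "\<And>t. t \<in> {a..b} \<Longrightarrow> norm (h t) \<le> P"
    using bdd(1) by (auto simp: bounded_pos)
  obtain Q where Q: "Q > 0" "\<And>t. t \<in> {a..b} \<Longrightarrow> norm (k t) \<le> Q"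
    using bdd(2) by (auto simp: bounded_pos)
  obtain K where K: "K > 0" "\<And>u v. norm (B u v) \<le> norm u * norm v * K"
    using pos_bounded by blast
  show ?thesis
  proof (rule absolutely_continuous_on_dominated[OF h k, of "(P + Q) * K"])
    fix u v assume uv: "a \<le> u" "u \<le> v" "v \<le> b"
    have "B (h v) (k v) - B (h u) (k u) = B (h v) (k v - k u) + B (h v - h u) (k u)"
      by (simp add: diff_left diff_right)
    then have "norm (B (h v) (k v) - B (h u) (k u))
        \<le> norm (B (h v) (k v - k u)) + norm (B (h v - h u) (k u))"
      using norm_triangle_ineq by metis
    also have "\<dots> \<le> norm (h v) * norm (k v - k u) * K + norm (h v - h u) * norm (k u) * K"
      by (intro add_mono K)
    also have "\<dots> \<le> (P + Q) * norm (k v - k u) * K + norm (h v - h u) * (P + Q) * K"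
      using P(2)[of v] Q(2)[of u] P(1) Q(1) K(1) uv
      by (intro add_mono mult_right_mono mult_left_mono) auto
    finally show "norm (B (h v) (k v) - B (h u) (k u))
        \<le> (P + Q) * K * (norm (h v - h u) + norm (k v - k u))"
      by (simp add: algebra_simps)
  qed (use P Q K in simp)
qed

lemma absolutely_continuous_on_indefinite_integral:
  fixes p :: "real \<Rightarrow> real"
  assumes "continuous_on {a..b} p"
  shows "absolutely_continuous_on a b (\<lambda>t. integral {a..t} p)"
proof -
  have "bounded (p ` {a..b})"
    by (intro compact_imp_bounded compact_continuous_image assms) simp
  then obtain C where C: "C > 0" "\<And>t. t \<in> {a..b} \<Longrightarrow> norm (p t) \<le> C"
    by (auto simp: bounded_pos)
  have ivl: "p integrable_on {u..v}" if "a \<le> u" "v \<le> b" for u v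
    by (rule integrable_continuous_real)
      (rule continuous_on_subset[OF assms], use that in auto)
  show ?thesis
  proof (rule absolutely_continuous_on_dominated[OF absolutely_continuous_on_id
        absolutely_continuous_on_id, of C])
    fix u v assume uv: "a \<le> u" "u \<le> v" "v \<le> b"
    have "integral {a..v} p - integral {a..u} p = integral {u..v} p"
      using Henstock_Kurzweil_Integration.integral_combine[of a u v p] ivl[of a v] uv by simp
    moreover have "norm (integral {u..v} p) \<le> C * (v - u)"
      by (rule integral_bound)
        (use uv C(2) in \<open>auto intro: continuous_on_subset[OF assms]\<close>)
    ultimately show "norm (integral {a..v} p - integral {a..u} p)
        \<le> C * (norm (v - u) + norm (v - u))"
      using C(1) uv by (simp add: algebra_simps add_increasing)
  qed (use C in simp)
qed

text \<open>The variation of an absolutely continuous function inside a small open set is small.  The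
  witness \<open>V s\<close> is the supremum of the sums of increments over finite families of
  non-overlapping intervals contained in the set and ending before \<open>s\<close>.\<close>

lemma absolutely_continuous_on_variation:
  fixes h :: "real \<Rightarrow> 'a::real_normed_vector"
  assumes h: "absolutely_continuous_on a b h" and e: "e > 0"
  obtains d where "d > 0" and "\<And>U. \<lbrakk>open U; emeasure lebesgue U < ennreal d\<rbrakk> \<Longrightarrow>
    \<exists>V::real \<Rightarrow> real. (\<forall>s\<in>{a..b}. 0 \<le> V s \<and> V s \<le> e) \<and>
      (\<forall>u v. a \<le> u \<longrightarrow> u \<le> v \<longrightarrow> v \<le> b \<longrightarrow> V u \<le> V v) \<and>
      (\<forall>u v. a \<le> u \<longrightarrow> u \<le> v \<longrightarrow> v \<le> b \<longrightarrow> {u<..<v} \<subseteq> U \<longrightarrow> V u + norm (h v - h u) \<le> V v)"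
proof -
  obtain d where d: "d > 0" and D: "\<And>n l r. \<lbrakk>nonoverlapping_in a b n l r; (\<Sum>i<n. r i - l i) < d\<rbrakk> \<Longrightarrow>
        (\<Sum>i<n. norm (h (r i) - h (l i))) < e"
    using h e unfolding absolutely_continuous_on_iff by meson
  show thesis
  proof (rule that[OF d])
    fix U :: "real set" assume U: "open U" and mU: "emeasure lebesgue U < ennreal d"
    define fam where "fam s n l r \<longleftrightarrow> nonoverlapping_in a s n l r \<and> (\<forall>i<n. {l i<..<r i} \<subseteq> U)"
      for s n l r
    define var where "var n l r = (\<Sum>i<n. norm (h (r i) - h (l i)))"
      for n :: nat and l r :: "nat \<Rightarrow> real"
    define F where "F s = {var n l r | n l r. fam s n l r}" for s
    define V where "V s = Sup (F s)" for s
    have U_lm: "U \<in> lmeasurable"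
      by (intro fmeasurableI) (use U mU in \<open>auto intro: less_trans[OF _ ennreal_less_top]\<close>)
    have "measure lebesgue U < d"
      using mU U_lm d by (simp add: emeasure_eq_measure2 ennreal_less_iff)
    have length: "(\<Sum>i<n. r i - l i) < d" if "fam s n l r" for s n l r
    proof -
      have "(\<Sum>i<n. r i - l i) = (\<Sum>i<n. measure lebesgue {l i<..<r i})"
        by (rule sum.cong) (use that in \<open>auto simp: fam_def nonoverlapping_in_def\<close>)
      also have "\<dots> = measure lebesgue (\<Union>i<n. {l i<..<r i})"
        by (rule measure_UNION'[symmetric])
          (use that in \<open>auto simp: fam_def nonoverlapping_in_def pairwise_def disjnt_def\<close>)
      also have "\<dots> \<le> measure lebesgue U"
        by (rule measure_mono_fmeasurable) (use that U_lm in \<open>auto simp: fam_def\<close>)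
      finally show ?thesis using \<open>measure lebesgue U < d\<close> by simp
    qed
    have var_le: "var n l r \<le> e" if "fam s n l r" "s \<le> b" for s n l r
    proof -
      have "var n l r < e" unfolding var_def
        by (rule D) (use that length[OF that(1)] in \<open>auto simp: fam_def nonoverlapping_in_def\<close>)
      then show ?thesis by simp
    qed
    have zero: "0 \<in> F s" for s
      unfolding F_def mem_Collect_eq
      by (rule exI[of _ 0], rule exI[of _ "\<lambda>_. 0"], rule exI[of _ "\<lambda>_. 0"])
        (simp add: var_def fam_def nonoverlapping_in_def)
    have F_le: "z \<le> e" if "z \<in> F s" "s \<le> b" for z s
      using that var_le by (auto simp: F_def)
    have bdd: "bdd_above (F s)" if "s \<le> b" for s
      using F_le[OF _ that] by (rule bdd_aboveI)
    have step: "V u + norm (h v - h u) \<le> V v"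
      if uv: "a \<le> u" "u \<le> v" "v \<le> b" "{u<..<v} \<subseteq> U" for u v
    proof -
      have "z + norm (h v - h u) \<in> F v" if "z \<in> F u" for z
      proof -
        obtain n l r where z: "z = var n l r" and fam: "fam u n l r"
          using \<open>z \<in> F u\<close> by (auto simp: F_def)
        have "var (Suc n) (l(n := u)) (r(n := v)) = z + norm (h v - h u)"
          by (simp add: var_def z)
        moreover have "fam v (Suc n) (l(n := u)) (r(n := v))"
        proof -
          have "r i \<le> u" if "i < n" for i
            using fam that by (auto simp: fam_def nonoverlapping_in_def)
          then have "{l i<..<r i} \<inter> {u<..<v} = {}" "{u<..<v} \<inter> {l i<..<r i} = {}" if "i < n" for i
            using that by fastforce+
          then show ?thesis
            using fam uv unfolding fam_def nonoverlapping_in_def by (simp add: less_Suc_eq) force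
        qed
        ultimately show ?thesis unfolding F_def by force
      qed
      then have "z \<le> V v - norm (h v - h u)" if "z \<in> F u" for z
        using cSup_upper[OF _ bdd[OF uv(3)]] that unfolding V_def by fastforce
      then have "V u \<le> V v - norm (h v - h u)"
        using zero[of u] unfolding V_def[of u] by (intro cSup_least) auto
      then show ?thesis by simp
    qed
    have mono: "V u \<le> V v" if "a \<le> u" "u \<le> v" "v \<le> b" for u v
    proof -
      have "fam v n l r" if "fam u n l r" for n l r
        using that \<open>u \<le> v\<close> unfolding fam_def nonoverlapping_in_def by (meson order.trans)
      then have "F u \<subseteq> F v"
        unfolding F_def by blast
      then show ?thesis
        unfolding V_def using zero[of u] bdd[OF that(3)] by (intro cSup_subset_mono) auto
    qed
    have "0 \<le> V s \<and> V s \<le> e" if "s \<in> {a..b}" for s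
      using cSup_upper[OF zero bdd] cSup_least[of "F s" e] zero[of s] F_le[of _ s] that
      unfolding V_def by auto
    with step mono
    show "\<exists>V::real \<Rightarrow> real. (\<forall>s\<in>{a..b}. 0 \<le> V s \<and> V s \<le> e) \<and>
      (\<forall>u v. a \<le> u \<longrightarrow> u \<le> v \<longrightarrow> v \<le> b \<longrightarrow> V u \<le> V v) \<and>
      (\<forall>u v. a \<le> u \<longrightarrow> u \<le> v \<longrightarrow> v \<le> b \<longrightarrow> {u<..<v} \<subseteq> U \<longrightarrow> V u + norm (h v - h u) \<le> V v)"
      by blast
  qed
qed

text \<open>The left difference quotients are what one controls when \<open>h\<close> is a convex function composed
  with a differentiable curve: a subgradient bounds them from above, whether or not the composition
  is differentiable.  The set of \<open>s\<close> for which
  \<open>h b - h s \<le> e * (b - s) + V b - V s\<close> contains \<open>b\<close>; its infimum belongs to it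
  because \<open>V\<close> is monotone and \<open>h\<close> continuous, and cannot exceed \<open>a\<close> since one can
  always move further left: by the bound on the left quotients outside \<open>N\<close>, and inside \<open>N\<close>
  because \<open>V\<close> pays for the increments of \<open>h\<close> there.\<close>

lemma absolutely_continuous_on_decreasing:
  fixes h :: "real \<Rightarrow> real"
  assumes h: "absolutely_continuous_on a b h" and "a \<le> b" and N: "negligible N"
    and left: "\<And>t e. \<lbrakk>a < t; t \<le> b; t \<notin> N; e > 0\<rbrakk> \<Longrightarrow>
      eventually (\<lambda>u. h t - h u \<le> e * (t - u)) (at_left t)"
  shows "h b \<le> h a"
proof -
  have approx: "h b - h a \<le> e * (b - a) + e" if e: "e > 0" for e
  proof -
    obtain d where d: "d > 0" and D: "\<And>U. \<lbrakk>open U; emeasure lebesgue U < ennreal d\<rbrakk> \<Longrightarrow>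
      \<exists>V::real \<Rightarrow> real. (\<forall>s\<in>{a..b}. 0 \<le> V s \<and> V s \<le> e) \<and>
        (\<forall>u v. a \<le> u \<longrightarrow> u \<le> v \<longrightarrow> v \<le> b \<longrightarrow> V u \<le> V v) \<and>
        (\<forall>u v. a \<le> u \<longrightarrow> u \<le> v \<longrightarrow> v \<le> b \<longrightarrow> {u<..<v} \<subseteq> U \<longrightarrow> V u + norm (h v - h u) \<le> V v)"
      using absolutely_continuous_on_variation[OF h e] by blast
    have N0: "N \<in> null_sets lebesgue"
      using N by (simp add: negligible_iff_null_sets)
    obtain U where U: "open U" "N \<subseteq> U" "emeasure lebesgue (U - N) < ennreal d"
      using sets_lebesgue_outer_open[OF _ d, of N] N0 by blast
    have "emeasure lebesgue U = emeasure lebesgue (U - N)"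
      using U(1) N0 by (simp add: emeasure_Diff_null_set)
    then obtain V :: "real \<Rightarrow> real" where V: "\<And>s. s \<in> {a..b} \<Longrightarrow> 0 \<le> V s \<and> V s \<le> e"
      and mono: "\<And>u v. \<lbrakk>a \<le> u; u \<le> v; v \<le> b\<rbrakk> \<Longrightarrow> V u \<le> V v"
      and step: "\<And>u v. \<lbrakk>a \<le> u; u \<le> v; v \<le> b; {u<..<v} \<subseteq> U\<rbrakk> \<Longrightarrow> V u + norm (h v - h u) \<le> V v"
      using D[of U] U by metis
    define S where "S = {s \<in> {a..b}. h b - h s \<le> e * (b - s) + V b - V s}"
    define m where "m = Inf S"
    have bS: "b \<in> S" using \<open>a \<le> b\<close> by (simp add: S_def)
    have bdd: "bdd_below S" by (rule bdd_belowI[of _ a]) (simp add: S_def)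
    have "m \<in> {s \<in> {a..b}. h b - h s \<le> e * (b - m) + V b - V m}"
      unfolding m_def
    proof (rule closed_subset_contains_Inf)
      show "closed {s \<in> {a..b}. h b - h s \<le> e * (b - Inf S) + V b - V (Inf S)}"
        by (intro continuous_on_closed_Collect_le continuous_intros
            absolutely_continuous_on_imp_continuous_on[OF h])
      have "a \<le> Inf S" using bS by (intro cInf_greatest) (auto simp: S_def)
      have "h b - h s \<le> e * (b - Inf S) + V b - V (Inf S)" if "s \<in> S" for s
      proof -
        have "Inf S \<le> s" using that bdd by (rule cInf_lower)
        moreover have "s \<le> b" "h b - h s \<le> e * (b - s) + V b - V s"
          using that by (auto simp: S_def)
        moreover have "e * (b - s) \<le> e * (b - Inf S)"
          using \<open>Inf S \<le> s\<close> e by (intro mult_left_mono) auto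
        ultimately show ?thesis
          using mono[of "Inf S" s] \<open>a \<le> Inf S\<close> by linarith
      qed
      then show "S \<subseteq> {s \<in> {a..b}. h b - h s \<le> e * (b - Inf S) + V b - V (Inf S)}"
        unfolding S_def by blast
    qed (use bS bdd in auto)
    then have mS: "m \<in> S" by (simp add: S_def)
    then have m: "a \<le> m" "m \<le> b" by (auto simp: S_def)
    have "m = a"
    proof (rule ccontr)
      assume "m \<noteq> a"
      then have "a < m" using m by simp
      have ex: "\<exists>u. a < u \<and> u < m \<and> h m - h u \<le> e * (m - u) + V m - V u"
      proof (cases "m \<in> N")
        case True
        then obtain r where r: "r > 0" "ball m r \<subseteq> U"
          using U open_contains_ball by blast
        define u where "u = max ((a + m) / 2) (m - r / 2)"
        have u: "a < u" "u < m" "m - r < u"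
          using \<open>a < m\<close> r(1) by (auto simp: u_def max_def field_simps)
        then have "{u<..<m} \<subseteq> ball m r" by (auto simp: dist_real_def)
        then have "V u + norm (h m - h u) \<le> V m"
          using u m r by (intro step) auto
        moreover have "e * (m - u) \<ge> 0" using e u by simp
        ultimately show ?thesis using u by (intro exI[of _ u]) auto
      next
        case False
        have "eventually (\<lambda>u. a < u \<and> u < m \<and> h m - h u \<le> e * (m - u)) (at_left m)"
          using left[OF \<open>a < m\<close> m(2) False e] eventually_at_left_real[OF \<open>a < m\<close>]
          by eventually_elim auto
        then obtain u where "a < u" "u < m" "h m - h u \<le> e * (m - u)"
          using eventually_happens'[OF trivial_limit_at_left_real] by blast
        then show ?thesis using mono[of u m] m by (intro exI[of _ u]) auto
      qed
      then obtain u where u: "a < u" "u < m" "h m - h u \<le> e * (m - u) + V m - V u"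
        by blast
      then have "u \<in> S" using mS m by (auto simp: S_def algebra_simps)
      then show False using cInf_lower[OF _ bdd, of u] u by (simp add: m_def)
    qed
    then show ?thesis using mS V[of a] V[of b] \<open>a \<le> b\<close> by (auto simp: S_def)
  qed
  have "h b - h a \<le> 0 + e" if e: "e > 0" for e
  proof -
    define c where "c = b - a + 1"
    have c: "c > 0" using \<open>a \<le> b\<close> by (simp add: c_def)
    have "h b - h a \<le> e / c * (b - a) + e / c"
      using e c by (intro approx) simp
    also have "\<dots> = e / c * c"
      unfolding c_def by (simp only: distrib_left mult_1_right)
    also have "\<dots> = 0 + e" using c by simp
    finally show ?thesis .
  qed
  then have "h b - h a \<le> 0" by (rule field_le_epsilon)
  then show ?thesis by simp
qed

lemma absolutely_continuous_on_deriv_zero: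
  fixes h :: "real \<Rightarrow> 'a::real_inner"
  assumes h: "absolutely_continuous_on a b h" and "a \<le> b" and N: "negligible N"
    and deriv: "\<And>t. \<lbrakk>a < t; t \<le> b; t \<notin> N\<rbrakk> \<Longrightarrow> (h has_vector_derivative 0) (at t)"
  shows "h b = h a"
proof -
  have le: "w \<bullet> h b \<le> w \<bullet> h a" for w
  proof (rule absolutely_continuous_on_decreasing[OF _ \<open>a \<le> b\<close> N])
    show "absolutely_continuous_on a b (\<lambda>t. w \<bullet> h t)"
      by (rule absolutely_continuous_on_bounded_linear[OF bounded_linear_inner_right h])
  next
    fix t e :: real assume t: "a < t" "t \<le> b" "t \<notin> N" and e: "e > 0"
    have "((\<lambda>t. w \<bullet> h t) has_real_derivative 0) (at t)"
      using bounded_linear.has_vector_derivative[OF bounded_linear_inner_right deriv[OF t], of w]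
      by (simp add: has_real_derivative_iff_has_vector_derivative)
    then have "((\<lambda>u. (w \<bullet> h u - w \<bullet> h t) / (u - t)) \<longlongrightarrow> 0) (at_left t)"
      by (auto simp: has_field_derivative_iff intro: tendsto_within_subset)
    then have "eventually (\<lambda>u. (w \<bullet> h u - w \<bullet> h t) / (u - t) < e) (at_left t)"
      using e by (rule order_tendstoD)
    then show "eventually (\<lambda>u. w \<bullet> h t - w \<bullet> h u \<le> e * (t - u)) (at_left t)"
      using eventually_at_left_real[OF t(1)]
      by eventually_elim (simp add: field_simps)
  qed
  have "(h b - h a) \<bullet> (h b - h a) \<le> 0"
    using le[of "h b - h a"] by (simp add: inner_diff_right)
  then show ?thesis
    using inner_gt_zero_iff[of "h b - h a"] by (simp add: not_less[symmetric])
qed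

section \<open>Projections, adjoints and weak limits in Hilbert spaces\<close>

text \<open>A minimizing sequence for the distance is Cauchy by the parallelogram law; the obtuse angle
  condition is the first-order condition at the minimizer.\<close>

lemma closed_convex_projection:
  fixes C :: "'a::{real_inner, banach} set"
  assumes "closed C" and "convex C" and "C \<noteq> {}"
  obtains p where "p \<in> C" and "\<And>z. z \<in> C \<Longrightarrow> (x - p) \<bullet> (z - p) \<le> 0"
proof -
  define I where "I = Inf ((\<lambda>z. (norm (x - z))\<^sup>2) ` C)"
  have bdd: "bdd_below ((\<lambda>z. (norm (x - z))\<^sup>2) ` C)"
    by (rule bdd_belowI2[of _ 0]) simp
  have I: "I \<le> (norm (x - z))\<^sup>2" if "z \<in> C" for z
    unfolding I_def by (rule cINF_lower[OF bdd that])
  have "\<exists>z\<in>C. (norm (x - z))\<^sup>2 < I + inverse (real (Suc n))" for n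
    using cInf_lessD[of "(\<lambda>z. (norm (x - z))\<^sup>2) ` C" "I + inverse (real (Suc n))"] \<open>C \<noteq> {}\<close>
    by (auto simp: I_def)
  then obtain z where zC: "\<And>n. z n \<in> C"
    and z: "\<And>n. (norm (x - z n))\<^sup>2 < I + inverse (real (Suc n))"
    by metis
  have near: "(norm (z m - z n))\<^sup>2 \<le> 2 * inverse (real (Suc m)) + 2 * inverse (real (Suc n))" for m n
  proof -
    \<comment> \<open>The midpoint is in \<open>C\<close>, hence not closer to \<open>x\<close> than the infimum.\<close>
    have "(1 / 2) *\<^sub>R z m + (1 / 2) *\<^sub>R z n \<in> C"
      using \<open>convex C\<close> zC zC by (rule convexD) auto
    then have "4 * I \<le> 4 * (norm (x - ((1 / 2) *\<^sub>R z m + (1 / 2) *\<^sub>R z n)))\<^sup>2"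
      using I by simp
    also have "\<dots> = 2 * (norm (x - z m))\<^sup>2 + 2 * (norm (x - z n))\<^sup>2 - (norm (z m - z n))\<^sup>2"
      by (simp add: power2_norm_eq_inner inner_diff_left inner_diff_right inner_add_left
          inner_add_right inner_commute algebra_simps)
    finally show ?thesis using z[of m] z[of n] by linarith
  qed
  have "Cauchy z"
  proof (rule CauchyI)
    fix e :: real assume "e > 0"
    then obtain N where N: "inverse (real (Suc N)) < e\<^sup>2 / 4"
      using reals_Archimedean[of "e\<^sup>2 / 4"] by auto
    have "norm (z m - z n) < e" if "m \<ge> N" "n \<ge> N" for m n
    proof (rule power2_less_imp_less)
      have "inverse (real (Suc m)) \<le> inverse (real (Suc N))"
        "inverse (real (Suc n)) \<le> inverse (real (Suc N))"
        using that by simp_all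
      then show "(norm (z m - z n))\<^sup>2 < e\<^sup>2" using near[of m n] N by linarith
    qed (use \<open>e > 0\<close> in simp)
    then show "\<exists>M. \<forall>m\<ge>M. \<forall>n\<ge>M. norm (z m - z n) < e" by blast
  qed
  then obtain p where p: "z \<longlonglongrightarrow> p"
    using Cauchy_convergent_iff convergent_def by blast
  have pC: "p \<in> C"
    using closed_sequentially[OF \<open>closed C\<close>] zC p by blast
  have "(\<lambda>n. I + inverse (real (Suc n))) \<longlonglongrightarrow> I + 0"
    by (intro tendsto_intros LIMSEQ_inverse_real_of_nat)
  moreover have "(\<lambda>n. (norm (x - z n))\<^sup>2) \<longlonglongrightarrow> (norm (x - p))\<^sup>2"
    by (intro tendsto_intros p)
  ultimately have pI: "(norm (x - p))\<^sup>2 \<le> I + 0"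
    using z by (intro LIMSEQ_le) (auto intro: less_imp_le)
  have "(x - p) \<bullet> (w - p) \<le> 0" if w: "w \<in> C" for w
  proof (rule ccontr)
    assume "\<not> (x - p) \<bullet> (w - p) \<le> 0"
    then have pos: "(x - p) \<bullet> (w - p) > 0" by simp
    \<comment> \<open>The step \<open>s\<close> is so short that the linear term beats the quadratic one.\<close>
    define q where "q = (norm (w - p))\<^sup>2"
    define s where "s = min 1 ((x - p) \<bullet> (w - p) / (q + 1))"
    have q: "q \<ge> 0" by (simp add: q_def)
    have s: "0 < s" "s \<le> 1" using pos q by (auto simp: s_def)
    have "s * (q + 1) \<le> (x - p) \<bullet> (w - p)"
      using q by (simp add: s_def pos_le_divide_eq[symmetric])
    then have "s * q < 2 * ((x - p) \<bullet> (w - p))"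
      using s pos by (simp add: algebra_simps)
    have "(1 - s) *\<^sub>R p + s *\<^sub>R w \<in> C"
      using \<open>convex C\<close> pC w by (rule convexD) (use s in auto)
    from I[OF this] pI have "(norm (x - p))\<^sup>2 \<le> (norm (x - ((1 - s) *\<^sub>R p + s *\<^sub>R w)))\<^sup>2"
      by linarith
    also have "x - ((1 - s) *\<^sub>R p + s *\<^sub>R w) = (x - p) - s *\<^sub>R (w - p)"
      by (simp add: algebra_simps)
    also have "(norm ((x - p) - s *\<^sub>R (w - p)))\<^sup>2
        = (norm (x - p))\<^sup>2 - s * (2 * ((x - p) \<bullet> (w - p)) - s * q)"
    proof -
      have "(norm (u - s *\<^sub>R v))\<^sup>2 = (norm u)\<^sup>2 - s * (2 * (u \<bullet> v) - s * (norm v)\<^sup>2)" for u v :: 'a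
        unfolding power2_norm_eq_inner
        by (simp add: inner_diff_left inner_diff_right inner_commute algebra_simps)
      then show ?thesis by (simp add: q_def)
    qed
    finally have "s * (2 * ((x - p) \<bullet> (w - p)) - s * q) \<le> 0" by simp
    then show False
      using \<open>s * q < _\<close> s by (simp add: mult_le_0_iff)
  qed
  with pC that show thesis by blast
qed

text \<open>The representing vector is the normal at the projection of the origin onto the level set
  \<open>{z. \<phi> z = 1}\<close>.\<close>

lemma riesz_representation:
  fixes \<phi> :: "'a::{real_inner, banach} \<Rightarrow> real"
  assumes "bounded_linear \<phi>"
  obtains q where "\<And>x. \<phi> x = x \<bullet> q"
proof (cases "\<forall>x. \<phi> x = 0")
  case True
  then show thesis by (intro that[of 0]) simp
next
  case False
  interpret bounded_linear \<phi> by fact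
  define C where "C = {z. \<phi> z = 1}"
  have neg: "\<phi> (- v) = - \<phi> v" for v using scaleR[of "-1" v] by simp
  obtain w where "\<phi> w \<noteq> 0" using False by blast
  then have "(1 / \<phi> w) *\<^sub>R w \<in> C" by (simp add: C_def scale)
  moreover have "closed C"
    unfolding C_def by (intro closed_Collect_eq continuous_on continuous_on_const continuous_on_id)
  moreover have "convex C"
    by (rule convexI) (simp add: C_def add scale)
  ultimately obtain p where pC: "p \<in> C" and p: "\<And>z. z \<in> C \<Longrightarrow> (0 - p) \<bullet> (z - p) \<le> 0"
    using closed_convex_projection[of C 0] by blast
  have le: "- (p \<bullet> v) \<le> 0" if "\<phi> v = 0" for v
    using p[of "p + v"] pC that by (simp add: C_def add)
  have ker: "p \<bullet> v = 0" if "\<phi> v = 0" for v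
    using le[of v] le[of "- v"] that by (simp add: neg)
  have "p \<noteq> 0" using pC by (auto simp: C_def zero)
  have "\<phi> x = x \<bullet> ((1 / (p \<bullet> p)) *\<^sub>R p)" for x
    using ker[of "x - \<phi> x *\<^sub>R p"] pC \<open>p \<noteq> 0\<close>
    by (simp add: C_def diff scale inner_diff_right inner_commute field_simps)
  then show thesis by (rule that)
qed

lemma inner_adjoint:
  fixes A :: "'a::{real_inner, banach} \<Rightarrow> 'b::real_inner"
  assumes "bounded_linear A"
  shows "A u \<bullet> v = u \<bullet> adjoint A v"
proof -
  have "\<exists>q. \<forall>u. A u \<bullet> v = u \<bullet> q" for v
    using riesz_representation[OF bounded_linear_compose[OF bounded_linear_inner_left assms]] by metis
  then have "\<exists>A'. \<forall>u v. A u \<bullet> v = u \<bullet> A' v" by metis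
  then have "\<forall>u v. A u \<bullet> v = u \<bullet> adjoint A v"
    unfolding adjoint_def by (rule someI_ex)
  then show ?thesis by blast
qed

text \<open>The projection \<open>p\<close> of the weak limit \<open>l\<close> onto the set satisfies
  \<open>(l - p) \<bullet> (z - p) \<le> 0\<close> along the sequence, and this passes to the weak limit, where it reads
  \<open>(l - p) \<bullet> (l - p) \<le> 0\<close>.\<close>

lemma weak_limit_in_closed_convex:
  fixes C :: "'a::{real_inner, banach} set"
  assumes "closed C" and "convex C" and ev: "eventually (\<lambda>k. z k \<in> C) sequentially"
    and weak: "\<And>w. (\<lambda>k. w \<bullet> z k) \<longlonglongrightarrow> w \<bullet> l"
  shows "l \<in> C"
proof -
  have "C \<noteq> {}" using eventually_happens[OF ev] by auto
  then obtain p where pC: "p \<in> C" and p: "\<And>z. z \<in> C \<Longrightarrow> (l - p) \<bullet> (z - p) \<le> 0"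
    using closed_convex_projection[OF assms(1,2)] by blast
  have "(\<lambda>k. (l - p) \<bullet> z k - (l - p) \<bullet> p) \<longlonglongrightarrow> (l - p) \<bullet> l - (l - p) \<bullet> p"
    by (intro tendsto_intros weak)
  moreover have "eventually (\<lambda>k. (l - p) \<bullet> z k - (l - p) \<bullet> p \<le> 0) sequentially"
    using ev by eventually_elim (use p in \<open>simp add: inner_diff_right\<close>)
  ultimately have "(l - p) \<bullet> l - (l - p) \<bullet> p \<le> 0"
    by (rule tendsto_upperbound) simp
  then have "(l - p) \<bullet> (l - p) \<le> 0" by (simp add: inner_diff_right)
  then have "l = p" using inner_gt_zero_iff[of "l - p"] by (simp add: not_less[symmetric])
  with pC show ?thesis by simp
qed

section \<open>Convex functions and their subgradients\<close>

lemma closed_sublevel_set: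
  assumes "lsc_fun f"
  shows "closed {u. f u \<le> c}"
proof -
  have "open {u. c < f u}"
    unfolding open_subopen[of "{u. c < f u}"]
  proof safe
    fix u assume "c < f u"
    then have "c < Liminf (nhds u) f"
      using assms by (metis lsc_fun_def order.strict_trans2)
    then have "eventually (\<lambda>w. c < f w) (nhds u)" by (rule less_LiminfD)
    then show "\<exists>T. open T \<and> u \<in> T \<and> T \<subseteq> {u. c < f u}"
      unfolding eventually_nhds by blast
  qed
  moreover have "- {u. c < f u} = {u. f u \<le> c}" by auto
  ultimately show ?thesis by (metis closed_Compl)
qed

lemma convex_sublevel_set:
  assumes "convex_fun f"
  shows "convex {u. f u \<le> ereal c}"
  unfolding convex_alt
proof (clarify)
  fix u w and s :: real
  assume fu: "f u \<le> ereal c" and fw: "f w \<le> ereal c" and s: "0 \<le> s" "s \<le> 1"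
  have "f ((1 - s) *\<^sub>R u + s *\<^sub>R w) \<le> ereal (1 - s) * f u + ereal s * f w"
    using assms s by (simp add: convex_fun_def)
  also have "\<dots> \<le> ereal (1 - s) * ereal c + ereal s * ereal c"
    using s by (intro add_mono ereal_mult_left_mono fu fw) auto
  also have "\<dots> = ereal c" by (simp add: algebra_simps)
  finally show "f ((1 - s) *\<^sub>R u + s *\<^sub>R w) \<le> ereal c" .
qed

lemma subdifferential_imp_finite:
  assumes "proper_fun f" and "\<xi> \<in> subdifferential f u"
  shows "\<bar>f u\<bar> \<noteq> \<infinity>"
proof -
  obtain z where "f z \<noteq> \<infinity>" using assms by (auto simp: proper_fun_def)
  moreover have "f u + ereal (\<xi> \<bullet> (z - u)) \<le> f z" using assms by (auto simp: subdifferential_def)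
  moreover have "f u \<noteq> - \<infinity>" using assms by (auto simp: proper_fun_def)
  ultimately show ?thesis by auto
qed

text \<open>The subgradient inequality at \<open>u + s *\<^sub>R (z - u)\<close> combined with strong convexity bounds
  \<open>f z - f u\<close> from below up to an error \<open>O(s)\<close>.\<close>

lemma strongly_convex_subgradient:
  assumes sc: "strongly_convex_fun \<mu> f" and sub: "\<xi> \<in> subdifferential f u"
    and fu: "f u = ereal p" and fz: "f z = ereal q"
  shows "p + \<xi> \<bullet> (z - u) + \<mu> / 2 * (norm (z - u))\<^sup>2 \<le> q"
proof -
  define d where "d = \<mu> / 2 * (norm (z - u))\<^sup>2"
  have le: "\<xi> \<bullet> (z - u) + (1 - s) * d \<le> q - p" if s: "0 < s" "s \<le> 1" for s
  proof -
    define w where "w = (1 - s) *\<^sub>R u + s *\<^sub>R z"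
    have "w - u = s *\<^sub>R (z - u)" by (simp add: w_def algebra_simps)
    then have 1: "ereal (p + s * (\<xi> \<bullet> (z - u))) \<le> f w"
      using sub fu by (auto simp: subdifferential_def dest!: spec[of _ w])
    have 2: "f w + ereal (s * ((1 - s) * d)) \<le> ereal ((1 - s) * p + s * q)"
    proof -
      have "f w + ereal (\<mu> / 2 * s * (1 - s) * (norm (u - z))\<^sup>2)
          \<le> ereal (1 - s) * f u + ereal s * f z"
        using sc s unfolding strongly_convex_fun_def w_def by simp
      then show ?thesis
        by (simp add: fu fz d_def norm_minus_commute[of u z] mult_ac)
    qed
    have "s * (\<xi> \<bullet> (z - u) + (1 - s) * d) \<le> s * (q - p)"
      using 1 2 by (cases "f w") (auto simp: algebra_simps)
    then show ?thesis using s by simp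
  qed
  have "((\<lambda>s. \<xi> \<bullet> (z - u) + (1 - s) * d) \<longlongrightarrow> \<xi> \<bullet> (z - u) + (1 - 0) * d) (at_right 0)"
    by (intro tendsto_intros)
  moreover have "eventually (\<lambda>s. \<xi> \<bullet> (z - u) + (1 - s) * d \<le> q - p) (at_right 0)"
    using eventually_at_right_real[of 0 1] by (rule eventually_mono) (use le in auto)
  ultimately have "\<xi> \<bullet> (z - u) + (1 - 0) * d \<le> q - p"
    by (rule tendsto_upperbound) simp
  then show ?thesis by (simp add: d_def)
qed

lemma fenchel_conjugate_indicator_at: "fenchel_conjugate (indicator_at b) v = ereal (v \<bullet> b)"
  unfolding fenchel_conjugate_def indicator_at_def
proof (rule antisym)
  show "(SUP w. ereal (v \<bullet> w) - (if w = b then 0 else \<infinity>)) \<le> ereal (v \<bullet> b)"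
    by (rule SUP_least) auto
  show "ereal (v \<bullet> b) \<le> (SUP w. ereal (v \<bullet> w) - (if w = b then 0 else \<infinity>))"
    by (rule SUP_upper2[of b]) auto
qed

lemma primal_dual_solutions_indicator_at:
  "(u, v) \<in> primal_dual_solutions f (indicator_at b) A \<longleftrightarrow>
     - adjoint A v \<in> subdifferential f u \<and> A u = b"
proof -
  have "A u = b" if "A u \<in> subdifferential (fenchel_conjugate (indicator_at b)) v"
  proof -
    have "v \<bullet> b + A u \<bullet> (z - v) \<le> z \<bullet> b" for z
      using that by (auto simp: subdifferential_def fenchel_conjugate_indicator_at)
    from this[of "v + (A u - b)"] have "(A u - b) \<bullet> (A u - b) \<le> 0"
      by (simp add: inner_simps inner_commute)
    then show ?thesis using inner_gt_zero_iff[of "A u - b"] by (simp add: not_less[symmetric])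
  qed
  then show ?thesis
    by (auto simp: primal_dual_solutions_def subdifferential_def fenchel_conjugate_indicator_at
        inner_simps inner_commute)
qed

lemma weakly_converges_inner:
  assumes "weakly_converges z l" and "bounded_linear B"
  shows "(\<lambda>k. w \<bullet> B (z k)) \<longlonglongrightarrow> w \<bullet> B l"
  using assms(1)[unfolded weakly_converges_def, rule_format,
      OF bounded_linear_compose[OF bounded_linear_inner_right[of w] assms(2)]] .

section \<open>The Lyapunov energy of the primal-dual flow\<close>

text \<open>This is the derivative of the Lyapunov energy along the flow.  Testing the primal inclusion with
  \<open>x - xb\<close> and with \<open>x'\<close>, and the dual equation with \<open>y - yb\<close>, all coupling terms cancel except
  \<open>- \<beta> * (y' \<bullet> (M *\<^sub>R A x' + X *\<^sub>R (A x - b)))\<close>, and by the dual equation once more this is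
  \<open>- \<beta> * \<delta> * (y' \<bullet> y')\<close>; the remaining terms are nonpositive by the subgradient inequality
  and because of \<open>- \<alpha> * (x' \<bullet> x')\<close>.  Here \<open>X\<close> is \<open>\<Xi> t\<close> and \<open>M\<close> is \<open>\<nu>\<^sub>0 + \<integral>\<Xi>\<close>.\<close>

lemma lyapunov_derivative_nonpos:
  fixes A :: "'a::{real_inner, banach} \<Rightarrow> 'b::real_inner" and \<alpha> \<beta> \<delta> X M p pb :: real
  assumes A: "bounded_linear A" and "A xb = b"
    and pos: "\<alpha> \<ge> 0" "\<beta> \<ge> 0" "\<delta> \<ge> 0" "X > 0" "M \<ge> 0"
    and primal: "\<alpha> *\<^sub>R x' + (X * \<beta>) *\<^sub>R adjoint A y' + X *\<^sub>R (\<xi> + adjoint A y) = 0"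
    and dual: "\<delta> *\<^sub>R y' = M *\<^sub>R A x' + X *\<^sub>R (A x - b)"
    and sub: "p + \<xi> \<bullet> (xb - x) \<le> pb"
  shows "\<alpha> * (x' \<bullet> (x - xb)) + \<delta> * (y' \<bullet> (y - yb)) + X * (p - pb + yb \<bullet> (A x - b))
    + M * (\<xi> \<bullet> x' + yb \<bullet> A x') \<le> 0"
proof -
  interpret A: bounded_linear A by fact
  define r where "r = A x - b"
  have r: "A (x - xb) = r" by (simp add: r_def A.diff \<open>A xb = b\<close>)
  have adj: "adjoint A v \<bullet> u = v \<bullet> A u" for u v
    using inner_adjoint[OF A, of u v] by (simp add: inner_commute)
  have test: "\<alpha> * (x' \<bullet> u) + X * \<beta> * (y' \<bullet> A u) + X * (\<xi> \<bullet> u + y \<bullet> A u) = 0" for u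
    using arg_cong[OF primal, of "\<lambda>w. w \<bullet> u"] by (simp add: inner_add_left adj)
  have 1: "\<alpha> * (x' \<bullet> (x - xb)) + X * \<beta> * (y' \<bullet> r) + X * (\<xi> \<bullet> (x - xb) + y \<bullet> r) = 0"
    using test[of "x - xb"] by (simp add: r)
  have 2: "\<delta> * (y' \<bullet> (y - yb)) = M * (A x' \<bullet> y - A x' \<bullet> yb) + X * (r \<bullet> y - r \<bullet> yb)"
    using arg_cong[OF dual, of "\<lambda>w. w \<bullet> (y - yb)"]
    by (simp add: inner_add_left inner_diff_right r_def right_diff_distrib)
  have 3: "\<beta> * (\<delta> * (y' \<bullet> y')) = \<beta> * (M * (y' \<bullet> A x') + X * (y' \<bullet> r))"
    using arg_cong[OF dual, of "\<lambda>w. y' \<bullet> w"]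
    by (simp add: inner_add_right r_def)
  have "X * (\<xi> \<bullet> x' + y \<bullet> A x' + \<beta> * (y' \<bullet> A x')) \<le> X * 0"
    using test[of x'] mult_nonneg_nonneg[OF pos(1) inner_ge_zero[of x']] by (simp add: algebra_simps)
  then have "\<xi> \<bullet> x' + y \<bullet> A x' + \<beta> * (y' \<bullet> A x') \<le> 0"
    using pos(4) by (simp only: mult_le_cancel_left_pos)
  then have 4: "M * (\<xi> \<bullet> x' + y \<bullet> A x' + \<beta> * (y' \<bullet> A x')) \<le> 0"
    using pos(5) by (intro mult_nonneg_nonpos)
  have 5: "X * (p - pb - \<xi> \<bullet> (x - xb)) \<le> 0"
    using sub pos(4) by (intro mult_nonneg_nonpos) (auto simp: inner_diff_right)
  have 6: "\<beta> * (\<delta> * (y' \<bullet> y')) \<ge> 0"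
    using pos by simp
  have "\<alpha> * (x' \<bullet> (x - xb)) + \<delta> * (y' \<bullet> (y - yb)) + X * (p - pb + yb \<bullet> r)
      + M * (\<xi> \<bullet> x' + yb \<bullet> A x')
    = X * (p - pb - \<xi> \<bullet> (x - xb)) + M * (\<xi> \<bullet> x' + y \<bullet> A x' + \<beta> * (y' \<bullet> A x'))
      - \<beta> * (\<delta> * (y' \<bullet> y'))"
    using 1 2 3 by (simp add: inner_commute algebra_simps)
  then show ?thesis using 4 5 6 by (simp add: r_def)
qed

text \<open>The system multiplied by \<open>\<Xi>\<close>, with \<open>M t = \<nu>\<^sub>0 + \<integral>\<Xi>\<close>; the coefficients of \<open>x'\<close> in the
  first line and of \<open>y'\<close> in the second are then constant, and \<open>M\<close> is a primitive of \<open>\<Xi>\<close>.\<close>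

locale rescaled_primal_dual_flow =
  fixes f :: "'a::{real_inner, banach} \<Rightarrow> ereal"
    and A :: "'a \<Rightarrow> 'b::{real_inner, banach}" and b :: 'b
    and \<alpha>\<^sub>0 \<delta>\<^sub>0 :: real and \<Xi> \<beta> M :: "real \<Rightarrow> real"
    and x :: "real \<Rightarrow> 'a" and y :: "real \<Rightarrow> 'b" and N :: "real set"
    and xb :: 'a and yb :: 'b
  assumes proper: "proper_fun f"
    and A: "bounded_linear A"
    and \<alpha>\<^sub>0: "\<alpha>\<^sub>0 > 0" and \<delta>\<^sub>0: "\<delta>\<^sub>0 > 0"
    and \<Xi>: "\<And>t. t > 0 \<Longrightarrow> \<Xi> t > 0"
    and \<beta>: "\<And>t. t > 0 \<Longrightarrow> \<beta> t \<ge> 0"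
    and M: "\<And>t. t \<ge> 0 \<Longrightarrow> M t > 0"
    and M_lac: "locally_absolutely_continuous M"
    and M_deriv: "\<And>t. t > 0 \<Longrightarrow> (M has_real_derivative \<Xi> t) (at t)"
    and x_lac: "locally_absolutely_continuous x"
    and y_lac: "locally_absolutely_continuous y"
    and fx_lac: "ereal_locally_absolutely_continuous (\<lambda>t. f (x t))"
    and N: "negligible N"
    and flow: "\<And>t. \<lbrakk>t > 0; t \<notin> N\<rbrakk> \<Longrightarrow> \<exists>x' y' \<xi>.
      (x has_vector_derivative x') (at t) \<and> (y has_vector_derivative y') (at t) \<and>
      \<xi> \<in> subdifferential f (x t) \<and>
      \<alpha>\<^sub>0 *\<^sub>R x' + (\<Xi> t * \<beta> t) *\<^sub>R adjoint A y' + \<Xi> t *\<^sub>R (\<xi> + adjoint A (y t)) = 0 \<and>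
      \<delta>\<^sub>0 *\<^sub>R y' = M t *\<^sub>R A x' + \<Xi> t *\<^sub>R (A (x t) - b)"
    and saddle: "- adjoint A yb \<in> subdifferential f xb" and feasible: "A xb = b"
begin

sublocale A: bounded_linear A by (fact A)

definition gap :: "real \<Rightarrow> real" where
  "gap t = real_of_ereal (f (x t)) - real_of_ereal (f xb) + yb \<bullet> (A (x t) - b)"

definition energy :: "real \<Rightarrow> real" where
  "energy t = \<alpha>\<^sub>0 / 2 * (norm (x t - xb))\<^sup>2 + \<delta>\<^sub>0 / 2 * (norm (y t - yb))\<^sup>2 + M t * gap t"

lemma f_xb: "f xb = ereal (real_of_ereal (f xb))"
  using subdifferential_imp_finite[OF proper saddle] by (simp add: ereal_real)

lemma f_x: "t \<ge> 0 \<Longrightarrow> f (x t) = ereal (real_of_ereal (f (x t)))"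
  using fx_lac by (simp add: ereal_real ereal_locally_absolutely_continuous_def)

lemma adjoint_multiplier: "- adjoint A yb \<bullet> (u - xb) = - (yb \<bullet> (A u - b))"
  using inner_adjoint[OF A, of "u - xb" yb] by (simp add: A.diff feasible inner_commute)

lemma gap_nonneg:
  assumes "t \<ge> 0"
  shows "gap t \<ge> 0"
proof -
  have "f xb + ereal (- adjoint A yb \<bullet> (x t - xb)) \<le> f (x t)"
    using saddle by (simp add: subdifferential_def)
  then have "ereal (real_of_ereal (f xb)) + ereal (- (yb \<bullet> (A (x t) - b))) \<le> ereal (real_of_ereal (f (x t)))"
    unfolding adjoint_multiplier f_xb[symmetric] f_x[OF assms, symmetric] .
  then show ?thesis by (simp add: gap_def)
qed

text \<open>The dual equation is exactly the statement that the derivative of this difference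
  vanishes.\<close>

lemma residual_conservation:
  assumes "t \<ge> 0"
  shows "M t *\<^sub>R (A (x t) - b) - \<delta>\<^sub>0 *\<^sub>R y t = M 0 *\<^sub>R (A (x 0) - b) - \<delta>\<^sub>0 *\<^sub>R y 0"
proof (rule absolutely_continuous_on_deriv_zero[OF _ assms N])
  show "absolutely_continuous_on 0 t (\<lambda>t. M t *\<^sub>R (A (x t) - b) - \<delta>\<^sub>0 *\<^sub>R y t)"
    using assms M_lac x_lac y_lac A unfolding locally_absolutely_continuous_def
    by (intro absolutely_continuous_on_diff absolutely_continuous_on_const
        absolutely_continuous_on_bounded_bilinear[OF bounded_bilinear_scaleR]
        absolutely_continuous_on_bounded_linear[of A]) auto
next
  fix s assume s: "0 < s" "s \<le> t" "s \<notin> N"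
  then obtain x' y' where x': "(x has_vector_derivative x') (at s)"
    and y': "(y has_vector_derivative y') (at s)"
    and dual: "\<delta>\<^sub>0 *\<^sub>R y' = M s *\<^sub>R A x' + \<Xi> s *\<^sub>R (A (x s) - b)"
    using flow by blast
  have "((\<lambda>t. M t *\<^sub>R (A (x t) - b) - \<delta>\<^sub>0 *\<^sub>R y t) has_vector_derivative
      (M s *\<^sub>R (A x' - 0) + \<Xi> s *\<^sub>R (A (x s) - b)) - \<delta>\<^sub>0 *\<^sub>R y') (at s)"
    by (intro has_vector_derivative_diff has_vector_derivative_scaleR M_deriv s
        A.has_vector_derivative x' has_vector_derivative_const
        bounded_linear.has_vector_derivative[OF bounded_linear_scaleR_right y'])
  then show "((\<lambda>t. M t *\<^sub>R (A (x t) - b) - \<delta>\<^sub>0 *\<^sub>R y t) has_vector_derivative 0) (at s)"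
    by (simp add: dual)
qed

text \<open>Replacing \<open>f (x u)\<close> by the affine minorant of \<open>f\<close> at \<open>x t\<close> given by the flow yields a
  function \<open>G\<close> that lies below the energy, touches it at \<open>t\<close> and is differentiable there, with
  nonpositive derivative.  Hence the left difference quotients of the energy at \<open>t\<close> are at most
  those of \<open>G\<close>.\<close>

lemma energy_decreasing:
  assumes "T \<ge> 0"
  shows "energy T \<le> energy 0"
proof (rule absolutely_continuous_on_decreasing[OF _ assms N])
  have "absolutely_continuous_on 0 T x" "absolutely_continuous_on 0 T y"
    "absolutely_continuous_on 0 T M" "absolutely_continuous_on 0 T (\<lambda>t. real_of_ereal (f (x t)))"
    using assms M_lac x_lac y_lac fx_lac
    unfolding locally_absolutely_continuous_def ereal_locally_absolutely_continuous_def by auto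
  then show "absolutely_continuous_on 0 T energy"
    unfolding energy_def gap_def power2_norm_eq_inner
    by (intro absolutely_continuous_on_add absolutely_continuous_on_diff
        absolutely_continuous_on_bounded_bilinear[OF bounded_bilinear_mult]
        absolutely_continuous_on_bounded_bilinear[OF bounded_bilinear_inner]
        absolutely_continuous_on_bounded_linear[OF A] absolutely_continuous_on_const)
next
  fix t e :: real assume t: "0 < t" "t \<le> T" "t \<notin> N" and e: "e > 0"
  obtain x' y' \<xi> where x': "(x has_vector_derivative x') (at t)"
    and y': "(y has_vector_derivative y') (at t)"
    and \<xi>: "\<xi> \<in> subdifferential f (x t)"
    and primal: "\<alpha>\<^sub>0 *\<^sub>R x' + (\<Xi> t * \<beta> t) *\<^sub>R adjoint A y' + \<Xi> t *\<^sub>R (\<xi> + adjoint A (y t)) = 0"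
    and dual: "\<delta>\<^sub>0 *\<^sub>R y' = M t *\<^sub>R A x' + \<Xi> t *\<^sub>R (A (x t) - b)"
    using flow[OF t(1,3)] by blast
  define p where "p = real_of_ereal (f (x t))"
  define pb where "pb = real_of_ereal (f xb)"
  have fxt: "f (x t) = ereal p" using f_x[of t] t by (simp add: p_def)
  have fxb: "f xb = ereal pb" using f_xb by (simp add: pb_def)
  have sub: "p + \<xi> \<bullet> (z - x t) \<le> q" if "f z = ereal q" for z q
    using \<xi> that fxt by (auto simp: subdifferential_def dest!: spec[of _ z])
  define G where "G u = \<alpha>\<^sub>0 / 2 * ((x u - xb) \<bullet> (x u - xb)) + \<delta>\<^sub>0 / 2 * ((y u - yb) \<bullet> (y u - yb))
      + M u * (p - pb + \<xi> \<bullet> (x u - x t) + yb \<bullet> (A (x u) - b))" for u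
  define D where "D = \<alpha>\<^sub>0 * (x' \<bullet> (x t - xb)) + \<delta>\<^sub>0 * (y' \<bullet> (y t - yb))
      + \<Xi> t * (p - pb + yb \<bullet> (A (x t) - b)) + M t * (\<xi> \<bullet> x' + yb \<bullet> A x')"
  have "D \<le> 0"
    unfolding D_def
    by (rule lyapunov_derivative_nonpos[OF A feasible _ _ _ _ _ primal dual])
      (use t \<alpha>\<^sub>0 \<delta>\<^sub>0 \<Xi> \<beta> M[of t] sub[OF fxb] in \<open>auto intro: less_imp_le\<close>)
  have G_deriv: "(G has_real_derivative D) (at t)"
  proof -
    have dx: "((\<lambda>u. x u - c) has_vector_derivative x') (at t)" for c
      using has_vector_derivative_diff[OF x' has_vector_derivative_const[of c]] by simp
    have dy: "((\<lambda>u. y u - c) has_vector_derivative y') (at t)" for c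
      using has_vector_derivative_diff[OF y' has_vector_derivative_const[of c]] by simp
    have dA: "((\<lambda>u. A (x u) - b) has_vector_derivative A x') (at t)"
      using has_vector_derivative_diff[OF A.has_vector_derivative[OF x'] has_vector_derivative_const[of b]]
      by simp
    have 1: "((\<lambda>u. (x u - xb) \<bullet> (x u - xb)) has_real_derivative
        (x t - xb) \<bullet> x' + x' \<bullet> (x t - xb)) (at t)"
      unfolding has_real_derivative_iff_has_vector_derivative
      by (rule bounded_bilinear.has_vector_derivative[OF bounded_bilinear_inner dx dx])
    have 2: "((\<lambda>u. (y u - yb) \<bullet> (y u - yb)) has_real_derivative
        (y t - yb) \<bullet> y' + y' \<bullet> (y t - yb)) (at t)"
      unfolding has_real_derivative_iff_has_vector_derivative
      by (rule bounded_bilinear.has_vector_derivative[OF bounded_bilinear_inner dy dy])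
    have 3: "((\<lambda>u. \<xi> \<bullet> (x u - x t)) has_real_derivative \<xi> \<bullet> x') (at t)"
      unfolding has_real_derivative_iff_has_vector_derivative
      by (rule bounded_linear.has_vector_derivative[OF bounded_linear_inner_right dx])
    have 4: "((\<lambda>u. yb \<bullet> (A (x u) - b)) has_real_derivative yb \<bullet> A x') (at t)"
      unfolding has_real_derivative_iff_has_vector_derivative
      by (rule bounded_linear.has_vector_derivative[OF bounded_linear_inner_right dA])
    show ?thesis
      unfolding G_def D_def
      by (rule derivative_eq_intros 1 2 3 4 M_deriv[OF t(1)] refl)+
        (simp add: inner_commute algebra_simps)
  qed
  then have "((\<lambda>u. (G u - G t) / (u - t)) \<longlongrightarrow> D) (at_left t)"
    by (auto simp: has_field_derivative_iff intro: tendsto_within_subset)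
  then have "eventually (\<lambda>u. (G u - G t) / (u - t) < e) (at_left t)"
    by (rule order_tendstoD(2)) (use e \<open>D \<le> 0\<close> in linarith)
  then show "eventually (\<lambda>u. energy t - energy u \<le> e * (t - u)) (at_left t)"
    using eventually_at_left_real[OF t(1)]
  proof eventually_elim
    case (elim u)
    then have u: "0 < u" "u < t" by auto
    then have "e * (u - t) < G u - G t" using elim by (simp add: neg_divide_less_eq)
    moreover have "energy t = G t"
      by (simp add: energy_def gap_def G_def p_def pb_def power2_norm_eq_inner)
    moreover have "G u \<le> energy u"
    proof -
      have "M u * (p - pb + \<xi> \<bullet> (x u - x t) + yb \<bullet> (A (x u) - b)) \<le> M u * gap u"
        using sub[OF f_x[of u]] M[of u] u unfolding gap_def pb_def
        by (intro mult_left_mono) auto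
      then show ?thesis by (simp add: energy_def G_def power2_norm_eq_inner)
    qed
    ultimately show ?case by (simp add: algebra_simps)
  qed
qed

lemma gap_bound:
  assumes "t \<ge> 0"
  shows "gap t \<le> energy 0 / M t"
proof -
  have "0 \<le> \<alpha>\<^sub>0 / 2 * (norm (x t - xb))\<^sup>2" "0 \<le> \<delta>\<^sub>0 / 2 * (norm (y t - yb))\<^sup>2"
    using \<alpha>\<^sub>0 \<delta>\<^sub>0 by simp_all
  then have "M t * gap t \<le> energy 0"
    using energy_decreasing[OF assms] unfolding energy_def[of t] by linarith
  then show ?thesis using M[OF assms] by (simp add: pos_le_divide_eq mult.commute)
qed

lemma distance_bound:
  assumes "t \<ge> 0"
  shows "\<alpha>\<^sub>0 / 2 * (norm (x t - xb))\<^sup>2 + \<delta>\<^sub>0 / 2 * (norm (y t - yb))\<^sup>2 \<le> energy 0"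
proof -
  have "M t * gap t \<ge> 0" using M[OF assms] gap_nonneg[OF assms] by simp
  then show ?thesis using energy_decreasing[OF assms] unfolding energy_def[of t] by linarith
qed

definition residual_constant :: real where
  "residual_constant = M 0 * norm (A (x 0) - b) + \<delta>\<^sub>0 * norm (yb - y 0) + sqrt (2 * \<delta>\<^sub>0 * energy 0)"

lemma residual_bound:
  assumes "t \<ge> 0"
  shows "norm (A (x t) - b) \<le> residual_constant / M t"
proof -
  have "\<delta>\<^sub>0 / 2 * (norm (y t - yb))\<^sup>2 \<le> energy 0"
  proof -
    have "\<alpha>\<^sub>0 / 2 * (norm (x t - xb))\<^sup>2 \<ge> 0" using \<alpha>\<^sub>0 by simp
    then show ?thesis using distance_bound[OF assms] by linarith
  qed
  then have "2 * \<delta>\<^sub>0 * (\<delta>\<^sub>0 / 2 * (norm (y t - yb))\<^sup>2) \<le> 2 * \<delta>\<^sub>0 * energy 0"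
    using \<delta>\<^sub>0 by (intro mult_left_mono) auto
  then have "(\<delta>\<^sub>0 * norm (y t - yb))\<^sup>2 \<le> 2 * \<delta>\<^sub>0 * energy 0"
    by (simp add: power2_eq_square mult_ac)
  then have y: "\<delta>\<^sub>0 * norm (y t - yb) \<le> sqrt (2 * \<delta>\<^sub>0 * energy 0)"
    by (rule real_le_rsqrt)
  have "M t *\<^sub>R (A (x t) - b)
      = M 0 *\<^sub>R (A (x 0) - b) + \<delta>\<^sub>0 *\<^sub>R (yb - y 0) + \<delta>\<^sub>0 *\<^sub>R (y t - yb)"
    using residual_conservation[OF assms] by (simp add: algebra_simps)
  then have "norm (M t *\<^sub>R (A (x t) - b))
      \<le> norm (M 0 *\<^sub>R (A (x 0) - b)) + norm (\<delta>\<^sub>0 *\<^sub>R (yb - y 0)) + norm (\<delta>\<^sub>0 *\<^sub>R (y t - yb))"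
    by (simp only: norm_triangle_le[OF add_right_mono[OF norm_triangle_ineq]])
  then have "M t * norm (A (x t) - b)
      \<le> M 0 * norm (A (x 0) - b) + \<delta>\<^sub>0 * norm (yb - y 0) + \<delta>\<^sub>0 * norm (y t - yb)"
    using M[OF assms] M[of 0] \<delta>\<^sub>0 by simp
  also have "\<dots> \<le> residual_constant"
    using y by (simp add: residual_constant_def)
  finally show ?thesis using M[OF assms] by (simp add: pos_le_divide_eq mult.commute)
qed

lemma objective_bound:
  assumes "t \<ge> 0"
  shows "\<bar>real_of_ereal (f (x t)) - real_of_ereal (f xb)\<bar>
    \<le> (energy 0 + norm yb * residual_constant) / M t"
proof -
  have "\<bar>yb \<bullet> (A (x t) - b)\<bar> \<le> norm yb * norm (A (x t) - b)"
    by (rule Cauchy_Schwarz_ineq2)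
  also have "\<dots> \<le> norm yb * (residual_constant / M t)"
    by (intro mult_left_mono residual_bound assms) simp
  finally have "\<bar>yb \<bullet> (A (x t) - b)\<bar> \<le> norm yb * residual_constant / M t" by simp
  then show ?thesis
    using gap_nonneg[OF assms] gap_bound[OF assms] unfolding gap_def add_divide_distrib by linarith
qed

text \<open>Strong convexity improves \<open>gap t \<ge> 0\<close> by a quadratic term.\<close>

lemma strongly_convex_distance_bound:
  assumes "t \<ge> 0" and "\<mu> > 0" and "strongly_convex_fun \<mu> f"
  shows "(norm (x t - xb))\<^sup>2 \<le> 2 * energy 0 / (\<mu> * M t)"
proof -
  have "real_of_ereal (f xb) + (- adjoint A yb) \<bullet> (x t - xb) + \<mu> / 2 * (norm (x t - xb))\<^sup>2
      \<le> real_of_ereal (f (x t))"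
    by (rule strongly_convex_subgradient[OF assms(3) saddle f_xb f_x[OF assms(1)]])
  then have "\<mu> / 2 * (norm (x t - xb))\<^sup>2 \<le> gap t"
    unfolding adjoint_multiplier gap_def by linarith
  also have "\<dots> \<le> energy 0 / M t" by (rule gap_bound[OF assms(1)])
  finally show ?thesis
    using M[OF assms(1)] \<open>\<mu> > 0\<close> by (simp add: field_simps)
qed

lemma residual_tendsto:
  assumes "filterlim M at_top at_top"
  shows "((\<lambda>t. A (x t)) \<longlongrightarrow> b) at_top"
proof -
  have "((\<lambda>t. residual_constant / M t) \<longlongrightarrow> 0) at_top"
    by (intro tendsto_divide_0[OF tendsto_const] filterlim_at_top_imp_at_infinity assms)
  then have "((\<lambda>t. A (x t) - b) \<longlongrightarrow> 0) at_top"
    by (rule Lim_null_comparison[rotated])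
      (use eventually_ge_at_top[of 0] in eventually_elim, rule residual_bound)
  then show ?thesis by (simp add: LIM_zero_iff)
qed

lemma objective_tendsto:
  assumes "filterlim M at_top at_top"
  shows "((\<lambda>t. real_of_ereal (f (x t))) \<longlongrightarrow> real_of_ereal (f xb)) at_top"
proof -
  have "((\<lambda>t. (energy 0 + norm yb * residual_constant) / M t) \<longlongrightarrow> 0) at_top"
    by (intro tendsto_divide_0[OF tendsto_const] filterlim_at_top_imp_at_infinity assms)
  then have "((\<lambda>t. real_of_ereal (f (x t)) - real_of_ereal (f xb)) \<longlongrightarrow> 0) at_top"
    by (rule Lim_null_comparison[rotated])
      (use eventually_ge_at_top[of 0] in eventually_elim, simp only: real_norm_def objective_bound)
  then show ?thesis by (simp add: LIM_zero_iff)
qed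

text \<open>Feasibility passes to the weak limit because \<open>A\<close> is weakly continuous, and optimality because
  the sublevel sets of \<open>f\<close> are closed and convex.  At a feasible point whose value does not exceed
  \<open>f xb\<close>, the subgradient inequality of \<open>f\<close> at \<open>xb\<close> is also one at that point.\<close>

lemma weak_limit_point_is_solution:
  assumes "convex_fun f" and "lsc_fun f" and M_top: "filterlim M at_top at_top"
    and "weak_limit_point_at_top (\<lambda>t. (x t, y t)) (xs, ys)"
  shows "(xs, yb) \<in> primal_dual_solutions f (indicator_at b) A"
proof -
  obtain s where s: "filterlim s at_top sequentially"
    and weak: "weakly_converges (\<lambda>k. (x (s k), y (s k))) (xs, ys)"
    using assms(4) unfolding weak_limit_point_at_top_def by blast
  have weak_x: "(\<lambda>k. w \<bullet> x (s k)) \<longlonglongrightarrow> w \<bullet> xs" for w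
    using weakly_converges_inner[OF weak bounded_linear_fst, of w] by simp
  have weak_Ax: "(\<lambda>k. w \<bullet> A (x (s k))) \<longlonglongrightarrow> w \<bullet> A xs" for w
    using weakly_converges_inner[OF weak bounded_linear_compose[OF A bounded_linear_fst], of w] by simp
  have "w \<bullet> A xs = w \<bullet> b" for w
    by (rule LIMSEQ_unique[OF weak_Ax])
      (intro tendsto_intros filterlim_compose[OF residual_tendsto[OF M_top] s])
  then have xs: "A xs = b" by (metis vector_eq_rdot inner_commute)
  have le: "f xs \<le> ereal c" if c: "real_of_ereal (f xb) < c" for c
  proof -
    have "eventually (\<lambda>k. real_of_ereal (f (x (s k))) < c \<and> s k \<ge> 0) sequentially"
      using order_tendstoD(2)[OF filterlim_compose[OF objective_tendsto[OF M_top] s] c]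
        filterlim_at_top[THEN iffD1, OF s, rule_format, of 0]
      by eventually_elim simp
    then have "eventually (\<lambda>k. x (s k) \<in> {u. f u \<le> ereal c}) sequentially"
    proof eventually_elim
      case (elim k)
      then have "ereal (real_of_ereal (f (x (s k)))) \<le> ereal c" by simp
      then show ?case using f_x[of "s k"] elim by simp
    qed
    then have "xs \<in> {u. f u \<le> ereal c}"
      by (rule weak_limit_in_closed_convex[OF closed_sublevel_set[OF assms(2)]
            convex_sublevel_set[OF assms(1)] _ weak_x])
    then show ?thesis by simp
  qed
  have "f xs \<le> ereal (real_of_ereal (f xb))"
  proof (rule dense_ge)
    fix z assume z: "ereal (real_of_ereal (f xb)) < z"
    then show "f xs \<le> z" using le by (cases z) auto
  qed
  then have "f xs \<le> f xb" using f_xb by simp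
  have "f xs + ereal (- adjoint A yb \<bullet> (z - xs)) \<le> f z" for z
  proof -
    have "- adjoint A yb \<bullet> (z - xs) = - adjoint A yb \<bullet> (z - xb)"
      using adjoint_multiplier[of xs] xs by (simp add: inner_diff_right)
    then have "f xs + ereal (- adjoint A yb \<bullet> (z - xs)) \<le> f xb + ereal (- adjoint A yb \<bullet> (z - xb))"
      using \<open>f xs \<le> f xb\<close> by (simp add: add_right_mono)
    also have "\<dots> \<le> f z" using saddle by (simp add: subdifferential_def)
    finally show ?thesis .
  qed
  then show ?thesis
    unfolding primal_dual_solutions_indicator_at subdifferential_def using xs by simp
qed

lemma strongly_convex_unique_minimizer:
  assumes "\<mu> > 0" and "strongly_convex_fun \<mu> f"
  shows "is_arg_min f (\<lambda>u. A u = b) z \<longleftrightarrow> z = xb"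
proof -
  have min: "f xb \<le> f u" if "A u = b" for u
    using saddle that adjoint_multiplier[of u]
    by (auto simp: subdifferential_def zero_ereal_def[symmetric] dest!: spec[of _ u])
  have "z = xb" if z: "A z = b" "\<not> f xb < f z"
  proof -
    have fz: "f z = ereal (real_of_ereal (f xb))"
      using min[OF z(1)] z(2) f_xb by simp
    have "real_of_ereal (f xb) + (- adjoint A yb) \<bullet> (z - xb) + \<mu> / 2 * (norm (z - xb))\<^sup>2
        \<le> real_of_ereal (f xb)"
      by (rule strongly_convex_subgradient[OF assms(2) saddle f_xb fz])
    then have "\<mu> / 2 * (norm (z - xb))\<^sup>2 \<le> 0"
      unfolding adjoint_multiplier by (simp add: z(1))
    then show ?thesis using \<open>\<mu> > 0\<close> by (simp add: mult_le_0_iff)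
  qed
  then show ?thesis
    using min feasible unfolding is_arg_min_def by (auto simp: not_less)
qed

lemma strongly_convex_tendsto:
  assumes "\<mu> > 0" and "strongly_convex_fun \<mu> f" and "filterlim M at_top at_top"
  shows "(x \<longlongrightarrow> xb) at_top"
proof -
  have "((\<lambda>t. 2 * energy 0 / \<mu> / M t) \<longlongrightarrow> 0) at_top"
    by (intro tendsto_divide_0[OF tendsto_const] filterlim_at_top_imp_at_infinity assms)
  then have "((\<lambda>t. (norm (x t - xb))\<^sup>2) \<longlongrightarrow> 0) at_top"
    by (rule Lim_null_comparison[rotated])
      (use eventually_ge_at_top[of 0] in eventually_elim,
        use strongly_convex_distance_bound[OF _ assms(1,2)] in simp)
  then have "((\<lambda>t. sqrt ((norm (x t - xb))\<^sup>2)) \<longlongrightarrow> sqrt 0) at_top"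
    by (rule tendsto_real_sqrt)
  then show ?thesis by (simp add: tendsto_norm_zero_iff LIM_zero_iff)
qed

lemma duality_gap_eq:
  assumes "t \<ge> 0"
  shows "duality_gap f (indicator_at b) A x y xb yb t = ereal (gap t)"
  unfolding duality_gap_def lagrangian_def fenchel_conjugate_indicator_at gap_def
  by (subst f_x[OF assms], subst f_xb) (simp add: feasible inner_diff_right)

end

section \<open>Convergence rates of the trajectory\<close>

lemma
  fixes \<zeta> \<Xi> :: "real \<Rightarrow> real"
  assumes \<zeta>: "\<And>t. t \<ge> 0 \<Longrightarrow> \<zeta> t \<ge> 0" and int: "\<And>T. T \<ge> 0 \<Longrightarrow> \<zeta> absolutely_integrable_on {0..T}"
    and \<Xi>: "\<And>t. t \<ge> 0 \<Longrightarrow> \<Xi> t = exp (integral {0..t} \<zeta>)"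
  shows growth_factor_ge_1: "t \<ge> 0 \<Longrightarrow> \<Xi> t \<ge> 1"
    and continuous_on_growth_factor: "continuous_on {0..T} \<Xi>"
proof -
  have "integral {0..t} \<zeta> \<ge> 0" if "t \<ge> 0" for t
    using \<zeta> by (intro integral_nonneg set_lebesgue_integral_eq_integral(1) int that) auto
  then show "t \<ge> 0 \<Longrightarrow> \<Xi> t \<ge> 1" by (simp add: \<Xi>)
  show "continuous_on {0..T} \<Xi>"
  proof (cases "T \<ge> 0")
    case True
    have "continuous_on {0..T} (\<lambda>t. exp (integral {0..t} \<zeta>))"
      by (intro continuous_intros indefinite_integral_continuous_1
          set_lebesgue_integral_eq_integral(1) int True)
    then show ?thesis
      by (rule continuous_on_cong[THEN iffD1, rotated -1]) (auto simp: \<Xi>)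
  qed simp
qed

theorem theorem3p3:
  fixes f :: "'a::{real_inner, banach} \<Rightarrow> ereal"
    and A :: "'a \<Rightarrow> 'b::{real_inner, banach}"
    and b :: 'b and g :: "'b \<Rightarrow> ereal"
    and \<zeta> \<Xi> \<alpha> \<beta> \<delta> \<nu> :: "real \<Rightarrow> real"
    and \<alpha>\<^sub>0 \<delta>\<^sub>0 \<nu>\<^sub>0 E\<^sub>0 K\<^sub>0 :: real
    and x :: "real \<Rightarrow> 'a" and y :: "real \<Rightarrow> 'b"
    and x\<^sub>0 xb :: 'a and y\<^sub>0 yb :: 'b
  assumes "proper_fun f" and "convex_fun f" and "lsc_fun f"
    and "bounded_linear A"
    and "g = indicator_at b"
    and "\<And>t. t \<ge> 0 \<Longrightarrow> \<zeta> t \<ge> 0"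
    and "\<And>T. T \<ge> 0 \<Longrightarrow> \<zeta> absolutely_integrable_on {0..T}"
    and "\<alpha>\<^sub>0 > 0" and "\<delta>\<^sub>0 > 0" and "\<nu>\<^sub>0 > 0"
    and "\<And>t. t \<ge> 0 \<Longrightarrow> \<Xi> t = exp (integral {0..t} \<zeta>)"
    and "\<And>t. t \<ge> 0 \<Longrightarrow> \<alpha> t = \<alpha>\<^sub>0 / \<Xi> t"
    and "\<And>t. t \<ge> 0 \<Longrightarrow> \<delta> t = \<delta>\<^sub>0 / \<Xi> t"
    and "\<And>t. t \<ge> 0 \<Longrightarrow> \<nu> t = 1 / \<Xi> t * (\<nu>\<^sub>0 + integral {0..t} \<Xi>)"
    and "\<And>t. t \<ge> 0 \<Longrightarrow> \<beta> t \<ge> 0"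
    and "trajectory f A b \<alpha> \<beta> \<delta> \<nu> x y"
    and "x 0 = x\<^sub>0" and "y 0 = y\<^sub>0"
    and "(xb, yb) \<in> primal_dual_solutions f g A"
    and "E\<^sub>0 = \<alpha>\<^sub>0 / 2 * (norm (x\<^sub>0 - xb))\<^sup>2 + \<delta>\<^sub>0 / 2 * (norm (y\<^sub>0 - yb))\<^sup>2
              + \<nu>\<^sub>0 * (real_of_ereal (f x\<^sub>0) - real_of_ereal (f xb) + yb \<bullet> (A x\<^sub>0 - b))"
    and "K\<^sub>0 = \<nu>\<^sub>0 * norm (A x\<^sub>0 - b) + \<delta>\<^sub>0 * norm (yb - y\<^sub>0) + sqrt (2 * \<delta>\<^sub>0 * E\<^sub>0)"
  shows
    "(\<forall>t\<ge>0.
        duality_gap f g A x y xb yb t \<le> ereal (E\<^sub>0 / (\<nu>\<^sub>0 + integral {0..t} \<Xi>)) \<and>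
        \<alpha>\<^sub>0 / 2 * (norm (x t - xb))\<^sup>2 + \<delta>\<^sub>0 / 2 * (norm (y t - yb))\<^sup>2 \<le> E\<^sub>0 \<and>
        norm (A (x t) - b) \<le> K\<^sub>0 / (\<nu>\<^sub>0 + integral {0..t} \<Xi>) \<and>
        \<bar>f (x t) - f xb\<bar> \<le> ereal ((E\<^sub>0 + norm yb * K\<^sub>0) / (\<nu>\<^sub>0 + integral {0..t} \<Xi>))) \<and>
     (\<forall>xs ys. weak_limit_point_at_top (\<lambda>t. (x t, y t)) (xs, ys) \<longrightarrow>
        (xs, yb) \<in> primal_dual_solutions f g A) \<and>
     (\<forall>\<mu>>0. strongly_convex_fun \<mu> f \<longrightarrow>
        (\<forall>t\<ge>0. (norm (x t - xb))\<^sup>2 \<le> 2 * E\<^sub>0 / (\<mu> * (\<nu>\<^sub>0 + integral {0..t} \<Xi>))) \<and>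
        (\<forall>z. is_arg_min f (\<lambda>u. A u = b) z \<longleftrightarrow> z = xb) \<and>
        (x \<longlongrightarrow> xb) at_top) \<and>
     (\<forall>L>0. smooth_fun L g \<longrightarrow>
        (\<forall>t\<ge>0. (norm (y t - yb))\<^sup>2 \<le> 2 * L * E\<^sub>0 / (\<nu>\<^sub>0 + integral {0..t} \<Xi>)))"
proof -
  note \<zeta> = assms(6,7) and \<Xi>_def = assms(11)
  define M where "M t = \<nu>\<^sub>0 + integral {0..t} \<Xi>" for t
  have \<Xi>: "\<Xi> t \<ge> 1" if "t \<ge> 0" for t
    using growth_factor_ge_1[OF \<zeta> \<Xi>_def that] .
  have \<Xi>_cont: "continuous_on {0..T} \<Xi>" for T
    using continuous_on_growth_factor[OF \<zeta> \<Xi>_def] .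
  have M_ge: "\<nu>\<^sub>0 + t \<le> M t" if "t \<ge> 0" for t
  proof -
    have "integral {0..t} (\<lambda>_. 1 :: real) \<le> integral {0..t} \<Xi>"
      by (rule integral_le) (auto intro: integrable_continuous_real \<Xi>_cont \<Xi>)
    then show ?thesis using that by (simp add: M_def)
  qed
  have M_top: "filterlim M at_top at_top"
  proof (rule filterlim_at_top_mono)
    show "filterlim (\<lambda>t. \<nu>\<^sub>0 + t) at_top at_top"
      by (intro filterlim_tendsto_add_at_top[OF tendsto_const] filterlim_ident)
    show "eventually (\<lambda>t. \<nu>\<^sub>0 + t \<le> M t) at_top"
      using eventually_ge_at_top[of 0] by eventually_elim (rule M_ge)
  qed
  have M_deriv: "(M has_real_derivative \<Xi> t) (at t)" if "t > 0" for t
  proof -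
    have "((\<lambda>t. integral {0..t} \<Xi>) has_real_derivative \<Xi> t) (at t within {0..t + 1})"
      using that by (intro integral_has_real_derivative \<Xi>_cont) auto
    then have "((\<lambda>t. integral {0..t} \<Xi>) has_real_derivative \<Xi> t) (at t)"
      using that by (subst (asm) at_within_interior) auto
    then show ?thesis
      unfolding M_def by (auto intro!: derivative_eq_intros)
  qed
  have M_lac: "locally_absolutely_continuous M"
    unfolding locally_absolutely_continuous_def M_def
    by (intro allI impI absolutely_continuous_on_add absolutely_continuous_on_const
        absolutely_continuous_on_indefinite_integral \<Xi>_cont)
  have saddle: "- adjoint A yb \<in> subdifferential f xb" "A xb = b"
    using assms(19) unfolding \<open>g = indicator_at b\<close> primal_dual_solutions_indicator_at by auto
  note traj = \<open>trajectory f A b \<alpha> \<beta> \<delta> \<nu> x y\<close>[unfolded trajectory_def]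
  obtain N where N: "negligible N" and flow: "\<And>t. \<lbrakk>t > 0; t \<notin> N\<rbrakk> \<Longrightarrow> \<exists>x' y'.
      (x has_vector_derivative x') (at t) \<and> (y has_vector_derivative y') (at t) \<and>
      0 \<in> {\<alpha> t *\<^sub>R x' + \<beta> t *\<^sub>R adjoint A y' + \<xi> + adjoint A (y t) | \<xi>.
              \<xi> \<in> subdifferential f (x t)} \<and>
      - (\<nu> t *\<^sub>R A x') + \<delta> t *\<^sub>R y' - A (x t) + b = 0"
    using traj unfolding eventually_ae_filter_negligible by blast
  interpret rescaled_primal_dual_flow f A b \<alpha>\<^sub>0 \<delta>\<^sub>0 \<Xi> \<beta> M x y N xb yb
  proof (rule rescaled_primal_dual_flow.intro)
    fix t assume t: "t > 0" "t \<notin> N"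
    obtain x' y' \<xi> where x': "(x has_vector_derivative x') (at t)"
      and y': "(y has_vector_derivative y') (at t)" and \<xi>: "\<xi> \<in> subdifferential f (x t)"
      and primal: "\<alpha> t *\<^sub>R x' + \<beta> t *\<^sub>R adjoint A y' + \<xi> + adjoint A (y t) = 0"
      and dual: "- (\<nu> t *\<^sub>R A x') + \<delta> t *\<^sub>R y' - A (x t) + b = 0"
      using flow[OF t] by auto
    have pos: "\<Xi> t > 0" using \<Xi>[of t] t by simp
    have coeff: "\<Xi> t * \<alpha> t = \<alpha>\<^sub>0" "\<Xi> t * \<delta> t = \<delta>\<^sub>0" "\<Xi> t * \<nu> t = M t"
      using assms(12-14)[of t] t pos by (auto simp: M_def)
    have "\<Xi> t *\<^sub>R (\<alpha> t *\<^sub>R x' + \<beta> t *\<^sub>R adjoint A y' + \<xi> + adjoint A (y t)) = 0"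
      unfolding primal by simp
    then have "\<alpha>\<^sub>0 *\<^sub>R x' + (\<Xi> t * \<beta> t) *\<^sub>R adjoint A y' + \<Xi> t *\<^sub>R (\<xi> + adjoint A (y t)) = 0"
      by (simp add: scaleR_add_right coeff add.assoc)
    moreover have "\<Xi> t *\<^sub>R (- (\<nu> t *\<^sub>R A x') + \<delta> t *\<^sub>R y' - A (x t) + b) = 0"
      unfolding dual by simp
    then have "\<delta>\<^sub>0 *\<^sub>R y' = M t *\<^sub>R A x' + \<Xi> t *\<^sub>R (A (x t) - b)"
      by (simp add: scaleR_add_right scaleR_diff_right coeff) (simp add: algebra_simps)
    ultimately show "\<exists>x' y' \<xi>. (x has_vector_derivative x') (at t) \<and>
        (y has_vector_derivative y') (at t) \<and> \<xi> \<in> subdifferential f (x t) \<and>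
        \<alpha>\<^sub>0 *\<^sub>R x' + (\<Xi> t * \<beta> t) *\<^sub>R adjoint A y' + \<Xi> t *\<^sub>R (\<xi> + adjoint A (y t)) = 0 \<and>
        \<delta>\<^sub>0 *\<^sub>R y' = M t *\<^sub>R A x' + \<Xi> t *\<^sub>R (A (x t) - b)"
      using x' y' \<xi> by blast
  next
    show "\<Xi> t > 0" if "t > 0" for t using \<Xi>[of t] that by simp
    show "M t > 0" if "t \<ge> 0" for t using M_ge[OF that] \<open>\<nu>\<^sub>0 > 0\<close> that by simp
  qed (use assms(1,4,8,9,15) traj N saddle M_lac M_deriv in auto)
  have E: "E\<^sub>0 = energy 0"
    unfolding assms(20) energy_def gap_def M_def by (simp add: assms(17,18))
  have K: "K\<^sub>0 = residual_constant"
    unfolding assms(21) residual_constant_def E M_def by (simp add: assms(17,18))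
  have objective: "\<bar>f (x t) - f xb\<bar> \<le> ereal ((E\<^sub>0 + norm yb * K\<^sub>0) / M t)" if "t \<ge> 0" for t
    unfolding E K
    by (subst f_x[OF that], subst f_xb) (use objective_bound[OF that] in simp)
  have smooth: "(norm (y t - yb))\<^sup>2 \<le> 2 * L * E\<^sub>0 / M t"
    if L: "L > 0" "smooth_fun L g" and t: "t \<ge> 0" for L t
  proof -
    \<comment> \<open>The indicator function of \<open>b\<close> is finite everywhere only if \<open>b\<close> is the only point.\<close>
    have "w = b" for w
      using L(2) unfolding smooth_fun_def \<open>g = indicator_at b\<close> indicator_at_def
      by (metis PInfty_neq_ereal(1))
    then have "y t = yb" by metis
    moreover have "energy 0 \<ge> 0"
      using gap_nonneg[of 0] M[of 0] \<open>\<alpha>\<^sub>0 > 0\<close> \<open>\<delta>\<^sub>0 > 0\<close> by (simp add: energy_def)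
    ultimately show ?thesis using L(1) M[OF t] by (simp add: E)
  qed
  show ?thesis
    unfolding M_def[symmetric] \<open>g = indicator_at b\<close>
  proof (intro conjI allI impI)
    fix t :: real assume t: "t \<ge> 0"
    show "duality_gap f (indicator_at b) A x y xb yb t \<le> ereal (E\<^sub>0 / M t)"
      using gap_bound[OF t] by (simp add: duality_gap_eq[OF t] E)
    show "\<alpha>\<^sub>0 / 2 * (norm (x t - xb))\<^sup>2 + \<delta>\<^sub>0 / 2 * (norm (y t - yb))\<^sup>2 \<le> E\<^sub>0"
      using distance_bound[OF t] by (simp add: E)
    show "norm (A (x t) - b) \<le> K\<^sub>0 / M t"
      using residual_bound[OF t] by (simp add: K)
    show "\<bar>f (x t) - f xb\<bar> \<le> ereal ((E\<^sub>0 + norm yb * K\<^sub>0) / M t)"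
      by (rule objective[OF t])
  next
    fix xs ys assume "weak_limit_point_at_top (\<lambda>t. (x t, y t)) (xs, ys)"
    then show "(xs, yb) \<in> primal_dual_solutions f (indicator_at b) A"
      by (rule weak_limit_point_is_solution[OF assms(2,3) M_top])
  next
    fix \<mu> t :: real assume "\<mu> > 0" "strongly_convex_fun \<mu> f" "t \<ge> 0"
    then show "(norm (x t - xb))\<^sup>2 \<le> 2 * E\<^sub>0 / (\<mu> * M t)"
      unfolding E by (intro strongly_convex_distance_bound)
  next
    fix \<mu> z assume "\<mu> > 0" "strongly_convex_fun \<mu> f"
    then show "is_arg_min f (\<lambda>u. A u = b) z \<longleftrightarrow> z = xb"
      by (rule strongly_convex_unique_minimizer)
  next
    fix \<mu> :: real assume "\<mu> > 0" "strongly_convex_fun \<mu> f"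
    then show "(x \<longlongrightarrow> xb) at_top"
      using M_top by (rule strongly_convex_tendsto)
  next
    fix L t :: real assume "L > 0" "smooth_fun L (indicator_at b)" "t \<ge> 0"
    then show "(norm (y t - yb))\<^sup>2 \<le> 2 * L * E\<^sub>0 / M t"
      using smooth \<open>g = indicator_at b\<close> by blast
  qed
qed

end
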